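(* Let $n^*\ge 1$ be a natural number and assume $\max(\mathrm{pcf}(\{\aleph_n : n<\omega\}))=\aleph_{\omega+n^*}$. Let $1<m^*<\omega$ and let $I$ be the ideal of finite subsets of $\omega$. Let $\langle A_i : 1\le i\le n^*\rangle$ be a sequence of pairwise disjoint subsets of $\omega\setminus(m^*+1)$ such that for each $1\le i\le n^*$ the reduced product $\prod_{k\in A_i}\aleph_k/I$ has true cofinality $\aleph_{\omega+i}$. Let $\langle \kappa_i : 1\le i\le n^*\rangle$ be a sequence of uncountable cardinals below $\aleph_{m^*+1}$. Then the set $$S=\{x\subseteq \aleph_\omega : |x|\le \aleph_{m^*} \text{ and for all } 1\le i\le n^* \text{ and all } k\in A_i,\ \mathrm{cf}(x\cap\aleph_k)=\kappa_i\}$$ is stationary in $[\aleph_\omega]^{<\aleph_{m^*+1}}$.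
   Context: For a set $\mathfrak a$ of regular cardinals, $\mathrm{pcf}(\mathfrak a)$ is the set of all true cofinalities of reduced products $\prod\mathfrak a/D$ for ultrafilters $D$ on $\mathfrak a$. A reduced product $\prod_{k\in A}\aleph_k/I$ has true cofinality $\mu$ if there is a sequence of length $\mu$ of functions in $\prod_{k\in A}\aleph_k$ that is increasing and cofinal with respect to the ordering $f<_I g$ iff $\{k: f(k)\ge g(k)\}\in I$. For a cardinal $\lambda$ and regular $\kappa$, $[\lambda]^{<\kappa}$ is the set of subsets of $\lambda$ of size $<\kappa$; a subset of $[\lambda]^{<\kappa}$ is stationary if it meets every closed unbounded subset of $[\lambda]^{<\kappa}$ (equivalently, for every structure on $\lambda$ with countable language there is an elementary substructure in the set). *)

theory Defs
  imports Main "HOL-Library.FuncSet" "HOL-Library.Disjoint_Sets"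
begin

unbundle cardinal_syntax

section \<open>Alephs and cofinalities\<close>

text \<open>
  Ordinals are the elements of a well-ordered type, and the ordinal \<open>\<alpha>\<close>, regarded as the set of
  its predecessors, is \<open>{..<\<alpha>}\<close>.  Cardinals that need not be represented in that type (true
  cofinalities, and the cardinals above \<open>\<aleph>\<^sub>\<omega>\<close>) are cardinal orders in the sense of the library,
  taken up to \<open>=o\<close>.
\<close>

primrec aleph :: "nat \<Rightarrow> 'a::wellorder" where
  "aleph 0 = (LEAST \<alpha>. infinite {..<\<alpha>})"
| "aleph (Suc n) = (LEAST \<alpha>. |{..<aleph n :: 'a}| <o |{..<\<alpha>}| )"

text \<open>
  No type of HOL can be proved to have \<open>\<aleph>\<^sub>\<omega>\<close> many elements.  The following predicate says that the
  type is long enough for every \<open>aleph n\<close> to exist, i.e. for the two \<open>LEAST\<close> above never to range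
  over the empty set; equivalently, its order type is at least \<open>\<aleph>\<^sub>\<omega>\<close>.
\<close>

definition alephs_exist :: "'a::wellorder itself \<Rightarrow> bool" where
  "alephs_exist _ \<longleftrightarrow>
     (\<exists>\<alpha>::'a. infinite {..<\<alpha>}) \<and> (\<forall>n. \<exists>\<alpha>::'a. |{..<aleph n :: 'a}| <o |{..<\<alpha>}| )"

text \<open>The von Neumann ordinal \<open>\<aleph>\<^sub>\<omega>\<close>; it is a set, since the type may have no element of this rank.\<close>

definition aleph_omega :: "'a::wellorder set" where
  "aleph_omega = (\<Union>n. {..<aleph n})"

text \<open>
  \<open>nth_cardSuc i r \<mu>\<close>: the cardinal \<open>\<mu>\<close> is the \<open>i\<close>-th cardinal successor of the cardinal \<open>r\<close>.
  In particular \<open>\<mu>\<close> is \<open>\<aleph>\<^bsub>\<omega>+i\<^esub>\<close> iff \<open>nth_cardSuc i |aleph_omega| \<mu>\<close>.  This is a relation rather than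
  an iteration of \<open>cardSuc\<close> because \<open>cardSuc\<close> changes the type.
\<close>

primrec nth_cardSuc :: "nat \<Rightarrow> 'b rel \<Rightarrow> 'c rel \<Rightarrow> bool" where
  "nth_cardSuc 0 r \<mu> \<longleftrightarrow> Card_order \<mu> \<and> \<mu> =o r"
| "nth_cardSuc (Suc i) r \<mu> \<longleftrightarrow>
     Card_order \<mu> \<and> (\<exists>\<nu>::'c rel. nth_cardSuc i r \<nu> \<and> \<mu> =o cardSuc \<nu>)"

definition is_cardinal :: "'a::wellorder \<Rightarrow> bool" where
  "is_cardinal \<alpha> \<longleftrightarrow> (\<forall>\<beta><\<alpha>. |{..<\<beta>}| <o |{..<\<alpha>}| )"

text \<open>The cofinality of the order type of a set of ordinals, as an ordinal.\<close>

definition cf :: "'a::wellorder set \<Rightarrow> 'a" where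
  "cf x = (LEAST \<alpha>. \<exists>y\<subseteq>x. (\<forall>\<xi>\<in>x. \<exists>\<eta>\<in>y. \<xi> \<le> \<eta>) \<and> |y| =o |{..<\<alpha>}| )"


section \<open>True cofinalities and pcf\<close>

definition less_mod ::
  "'i set \<Rightarrow> 'i set set \<Rightarrow> ('i \<Rightarrow> 'a::linorder) \<Rightarrow> ('i \<Rightarrow> 'a) \<Rightarrow> bool" where
  "less_mod A I f g \<longleftrightarrow> {k\<in>A. f k \<ge> g k} \<in> I"

text \<open>
  \<open>has_tcf A c I \<mu>\<close>: the reduced product of the ordinals \<open>c k\<close>, \<open>k \<in> A\<close>, modulo the ideal \<open>I\<close> has
  true cofinality \<open>\<mu>\<close>.  As usual, a true cofinality is a regular cardinal.
\<close>

definition has_tcf ::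
  "'i set \<Rightarrow> ('i \<Rightarrow> 'a::wellorder) \<Rightarrow> 'i set set \<Rightarrow> 'b rel \<Rightarrow> bool" where
  "has_tcf A c I \<mu> \<longleftrightarrow>
     Cinfinite \<mu> \<and> regularCard \<mu> \<and>
     (\<exists>F. (\<forall>\<alpha>\<in>Field \<mu>. F \<alpha> \<in> (\<Pi>\<^sub>E k\<in>A. {..<c k})) \<and>
          (\<forall>\<alpha> \<beta>. (\<alpha>, \<beta>) \<in> \<mu> \<and> \<alpha> \<noteq> \<beta> \<longrightarrow> less_mod A I (F \<alpha>) (F \<beta>)) \<and>
          (\<forall>g\<in>(\<Pi>\<^sub>E k\<in>A. {..<c k}). \<exists>\<alpha>\<in>Field \<mu>. less_mod A I g (F \<alpha>)))"

definition ultrafilter_on :: "'i set \<Rightarrow> 'i set set \<Rightarrow> bool" where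
  "ultrafilter_on a D \<longleftrightarrow>
     D \<subseteq> Pow a \<and> a \<in> D \<and> {} \<notin> D \<and>
     (\<forall>X\<in>D. \<forall>Y\<in>D. X \<inter> Y \<in> D) \<and>
     (\<forall>X\<in>D. \<forall>Y. X \<subseteq> Y \<and> Y \<subseteq> a \<longrightarrow> Y \<in> D) \<and>
     (\<forall>X. X \<subseteq> a \<longrightarrow> X \<in> D \<or> a - X \<in> D)"

definition dual_ideal :: "'i set \<Rightarrow> 'i set set \<Rightarrow> 'i set set" where
  "dual_ideal a D = {a - X | X. X \<in> D}"

text \<open>
  The cardinals in \<open>pcf a\<close> are represented on the type of the functions in the product.  Nothing is
  lost: for an ultrafilter \<open>D\<close>, a \<open><\<^sub>D\<close>-increasing sequence is injective, so every true cofinality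
  of the product of \<open>a\<close> modulo \<open>D\<close> has a representative on this type.
\<close>

definition pcf :: "'a::wellorder set \<Rightarrow> ('a \<Rightarrow> 'a) rel set" where
  "pcf a = {\<mu>. \<exists>D. ultrafilter_on a D \<and> has_tcf a (\<lambda>\<alpha>. \<alpha>) (dual_ideal a D) \<mu>}"

definition is_max_pcf :: "'a::wellorder set \<Rightarrow> ('a \<Rightarrow> 'a) rel \<Rightarrow> bool" where
  "is_max_pcf a \<mu> \<longleftrightarrow> \<mu> \<in> pcf a \<and> (\<forall>\<nu>\<in>pcf a. \<nu> \<le>o \<mu>)"


section \<open>Stationary sets\<close>

definition subsets_lt :: "'a set \<Rightarrow> 'b rel \<Rightarrow> 'a set set" where
  "subsets_lt X \<kappa> = {x. x \<subseteq> X \<and> |x| <o \<kappa>}"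

text \<open>
  Closure is stated for nonempty \<open>\<subseteq>\<close>-chains of fewer than \<open>\<kappa>\<close> members; this agrees with closure
  under unions of increasing sequences of length less than \<open>\<kappa>\<close>.
\<close>

definition club_in :: "'a set set \<Rightarrow> 'a set \<Rightarrow> 'b rel \<Rightarrow> bool" where
  "club_in C X \<kappa> \<longleftrightarrow>
     C \<subseteq> subsets_lt X \<kappa> \<and>
     (\<forall>x\<in>subsets_lt X \<kappa>. \<exists>y\<in>C. x \<subseteq> y) \<and>
     (\<forall>\<C>. subset.chain C \<C> \<and> \<C> \<noteq> {} \<and> |\<C>| <o \<kappa> \<longrightarrow> \<Union>\<C> \<in> C)"

definition stationary_in :: "'a set set \<Rightarrow> 'a set \<Rightarrow> 'b rel \<Rightarrow> bool" where
  "stationary_in S X \<kappa> \<longleftrightarrow>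
     S \<subseteq> subsets_lt X \<kappa> \<and> (\<forall>C. club_in C X \<kappa> \<longrightarrow> S \<inter> C \<noteq> {})"

end

(*
  A club C yields a finitary hull operator cl with cl(X) in C for all small X, so it is enough to
  find generators Y such that cl(Y) has the prescribed cofinalities.

  Let F be the scale for A_i, of length mu = aleph_{omega+i}.  Adding the values of F_gamma for
  gamma in an increasing sequence of length kappa_i, each term of which dominates the hull of the
  previous ones mod finite, gives cofinality kappa_i at almost all k in A_i: since kappa_i is
  uncountable and regular, the same finite set of exceptions occurs cofinally often.  The levels are
  treated from i = n down to 1.  To keep the cofinalities on A_j when levels i < j are
  added later, the sequences at level i are taken inside members of a family of only mu many small
  sets that is fixed beforehand (namely, a club in each ordinal below mu).  There are
  fewer than aleph_{omega+j} combinations of such sets, so one element of the scale for A_j dominates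
  the hulls enlarged by all of them at once.

  All hulls at k are moreover taken together with all ordinals below aleph_{k-1}.  Hence the finitely
  many remaining k can be repaired by adding ordinals below some aleph_K, without affecting the
  cofinalities at larger k; the repair proceeds downwards from K for the same reason.
*)

theory Submission
  imports Defs "HOL-Library.Nat_Bijection"
begin


section \<open>Alephs and regularity\<close>

declare aleph.simps(2) [simp del]

text \<open>The natural order of \<open>{..<\<kappa>}\<close> is a well-order at least as long as
  the cardinal order on that set, so the shorter order \<open>|y|\<close> is isomorphic to a proper
  initial segment of it. This turns abstract cardinals into ordinals, of which the
  \<open>LEAST\<close> in \<open>aleph\<close> can speak.\<close>

lemma ordLess_card_initial_segment:
  fixes \<kappa> :: "'a::wellorder"
  assumes "|y| <o |{..<\<kappa>}|"
  obtains \<alpha> where "\<alpha> < \<kappa>" "|y| =o |{..<\<alpha>}|"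
proof -
  let ?r = "{(a, b). a \<le> b \<and> b < \<kappa>}"
  have field: "Field ?r = {..<\<kappa>}"
    by (auto simp: Field_def)
  have "wf (?r - Id)"
    by (rule wf_subset[OF wf]) auto
  then have wo: "well_order_on {..<\<kappa>} ?r"
    unfolding order_on_defs by (auto simp: refl_on_def trans_def antisym_def total_on_def)
  then have "|y| <o ?r"
    using assms card_of_least ordLess_ordLeq_trans by blast
  then obtain \<alpha> where \<alpha>: "\<alpha> \<in> {..<\<kappa>}" "|y| =o Restr ?r (underS ?r \<alpha>)"
    using ordLess_iff_ordIso_Restr[of ?r "|y|"] wo card_of_Well_order unfolding field by blast
  have under: "underS ?r \<alpha> = {..<\<alpha>}"
    using \<alpha>(1) by (auto simp: field underS_def)
  have "Field (Restr ?r {..<\<alpha>}) = {..<\<alpha>}"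
    using \<alpha>(1) by (auto simp: field Field_def)
  then have "|y| =o |{..<\<alpha>}|"
    using card_of_cong[OF \<alpha>(2)] by (simp add: Field_card_of under)
  then show ?thesis
    using that \<alpha>(1) by (auto simp: field)
qed

context
  assumes alephs: "alephs_exist TYPE('a::wellorder)"
begin

lemma ordLess_aleph_Suc: "|{..<aleph n :: 'a}| <o |{..<aleph (Suc n) :: 'a}|"
  using alephs LeastI_ex[of "\<lambda>\<alpha>::'a. |{..<aleph n :: 'a}| <o |{..<\<alpha>}|"]
  unfolding alephs_exist_def aleph.simps(2) by blast

lemma infinite_aleph: "infinite {..<aleph n :: 'a}"
proof (induction n)
  case 0
  then show ?case
    using alephs LeastI_ex[of "\<lambda>\<alpha>::'a. infinite {..<\<alpha>}"]
    unfolding alephs_exist_def aleph.simps(1) by blast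
next
  case (Suc n)
  then show ?case
    using ordLess_aleph_Suc[of n] card_of_ordLeq_infinite ordLess_imp_ordLeq by blast
qed

lemma aleph_less_Suc: "(aleph n :: 'a) < aleph (Suc n)"
proof (rule ccontr)
  assume "\<not> (aleph n :: 'a) < aleph (Suc n)"
  then have "|{..<aleph (Suc n) :: 'a}| \<le>o |{..<aleph n :: 'a}|"
    by (intro card_of_mono1) auto
  then show False
    using ordLess_aleph_Suc not_ordLess_ordLeq by blast
qed

lemma aleph_strict_mono: "strict_mono (aleph :: nat \<Rightarrow> 'a)"
  using aleph_less_Suc by (simp add: strict_mono_Suc_iff)

lemma aleph_mono: "i \<le> j \<Longrightarrow> (aleph i :: 'a) \<le> aleph j"
  using aleph_strict_mono by (simp add: strict_mono_less_eq)

lemma ordLeq_aleph_mono: "i \<le> j \<Longrightarrow> |{..<aleph i :: 'a}| \<le>o |{..<aleph j :: 'a}|"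
  using aleph_mono by (intro card_of_mono1) force

lemma ordLeq_aleph_trans: "|X| \<le>o |{..<aleph i :: 'a}| \<Longrightarrow> i \<le> j \<Longrightarrow> |X| \<le>o |{..<aleph j :: 'a}|"
  using ordLeq_aleph_mono ordLeq_transitive by blast

text \<open>A cardinality strictly in between would be that of some \<open>{..<\<alpha>}\<close>
  with \<open>\<alpha> < aleph (Suc n)\<close>, against the minimality of
  \<open>aleph (Suc n)\<close>.\<close>

lemma ordLess_aleph_Suc_iff: "|y| <o |{..<aleph (Suc n) :: 'a}| \<longleftrightarrow> |y| \<le>o |{..<aleph n :: 'a}|"
proof
  assume "|y| <o |{..<aleph (Suc n) :: 'a}|"
  then obtain \<alpha> where \<alpha>: "\<alpha> < (aleph (Suc n) :: 'a)" "|y| =o |{..<\<alpha>}|"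
    by (rule ordLess_card_initial_segment)
  have "\<not> |{..<aleph n :: 'a}| <o |{..<\<alpha>}|"
    using \<alpha>(1) not_less_Least unfolding aleph.simps(2) by blast
  then show "|y| \<le>o |{..<aleph n :: 'a}|"
    using \<alpha>(2) not_ordLess_iff_ordLeq card_of_Well_order ordIso_ordLeq_trans by blast
next
  assume "|y| \<le>o |{..<aleph n :: 'a}|"
  then show "|y| <o |{..<aleph (Suc n) :: 'a}|"
    using ordLess_aleph_Suc ordLeq_ordLess_trans by blast
qed

lemma countable_ordLeq_aleph: "|B :: nat set| \<le>o |{..<aleph n :: 'a}|"
  by (meson card_of_mono1 subset_UNIV infinite_aleph infinite_iff_card_of_nat ordLeq_transitive)

lemma finite_ordLeq_aleph: "finite B \<Longrightarrow> |B| \<le>o |{..<aleph n :: 'a}|"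
  using finite_iff_ordLess_natLeq infinite_iff_natLeq_ordLeq infinite_aleph
    ordLess_ordLeq_trans ordLess_imp_ordLeq by metis

lemma Un_ordLeq_aleph:
  "|A| \<le>o |{..<aleph n :: 'a}| \<Longrightarrow> |B| \<le>o |{..<aleph n :: 'a}| \<Longrightarrow> |A \<union> B| \<le>o |{..<aleph n :: 'a}|"
  using card_of_Un_ordLeq_infinite_Field[of "|{..<aleph n :: 'a}|" A B] infinite_aleph card_of_Card_order
  unfolding Field_card_of by blast

lemma UN_ordLeq_aleph:
  "|I| \<le>o |{..<aleph n :: 'a}| \<Longrightarrow> (\<And>i. i \<in> I \<Longrightarrow> |A i| \<le>o |{..<aleph n :: 'a}| )
    \<Longrightarrow> |\<Union>i\<in>I. A i| \<le>o |{..<aleph n :: 'a}|"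
  using card_of_UNION_ordLeq_infinite[of "{..<aleph n :: 'a}"] infinite_aleph by blast

lemma image_ordLeq: "|A| \<le>o r \<Longrightarrow> |f ` A| \<le>o r"
  using card_of_image ordLeq_transitive by blast

text \<open>Regularity of successor alephs: an unbounded \<open>B\<close> would cover
  \<open>aleph (Suc n)\<close> by at most \<open>aleph n\<close> many sets, each of size at most
  \<open>aleph n\<close>.\<close>

lemma bounded_below_aleph_Suc:
  assumes "B \<subseteq> {..<aleph (Suc n) :: 'a}" "|B| \<le>o |{..<aleph n :: 'a}|"
  obtains \<beta> where "\<beta> < aleph (Suc n)" "B \<subseteq> {..<\<beta>}"
proof (rule ccontr)
  assume "\<not> thesis"
  then have unb: "\<forall>\<beta><aleph (Suc n). \<exists>b\<in>B. \<beta> \<le> b"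
    using that by (metis lessThan_iff not_less subsetI)
  have "|{..<b}| <o |{..<aleph (Suc n) :: 'a}|" if "b \<in> B" for b
  proof -
    have "b < aleph (Suc n)"
      using that assms by auto
    then have "\<not> |{..<aleph n :: 'a}| <o |{..<b}|"
      using not_less_Least unfolding aleph.simps(2) by blast
    then show ?thesis
      unfolding ordLess_aleph_Suc_iff using not_ordLess_iff_ordLeq card_of_Well_order by blast
  qed
  then have "|{..<b} \<union> {b}| \<le>o |{..<aleph n :: 'a}|" if "b \<in> B" for b
    using that ordLess_aleph_Suc_iff by (intro Un_ordLeq_aleph) (auto intro: finite_ordLeq_aleph)
  then have "|\<Union>b\<in>B. {..<b} \<union> {b}| \<le>o |{..<aleph n :: 'a}|"
    using assms by (intro UN_ordLeq_aleph)
  moreover have "{..<aleph (Suc n)} \<subseteq> (\<Union>b\<in>B. {..<b} \<union> {b})"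
  proof
    fix \<beta>
    assume "\<beta> \<in> {..<aleph (Suc n) :: 'a}"
    then obtain b where "b \<in> B" "\<beta> \<le> b"
      using unb by auto
    then show "\<beta> \<in> (\<Union>b\<in>B. {..<b} \<union> {b})"
      by (intro UN_I[of b]) auto
  qed
  ultimately have "|{..<aleph (Suc n) :: 'a}| \<le>o |{..<aleph n :: 'a}|"
    using card_of_mono1 ordLeq_transitive by blast
  then show False
    using ordLess_aleph_Suc not_ordLess_ordLeq by blast
qed

text \<open>The regularity of the prescribed cofinalities comes from here, since successor alephs
  are regular. The least \<open>i\<close> with \<open>\<kappa> \<le> aleph i\<close> is not 0, and a
  cardinal above the preceding aleph cannot stay below \<open>aleph i\<close>.\<close>

lemma cardinal_between_alephs:
  fixes \<kappa> :: 'a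
  assumes "is_cardinal \<kappa>" "aleph 0 < \<kappa>" "\<kappa> < aleph (Suc m)"
  obtains j where "j < m" "\<kappa> = aleph (Suc j)"
proof -
  define i where "i = (LEAST i. \<kappa> \<le> aleph i)"
  have ex: "\<kappa> \<le> aleph (Suc m)"
    using assms by simp
  have i: "\<kappa> \<le> aleph i"
    unfolding i_def using ex by (rule LeastI)
  have "i \<noteq> 0"
    using i assms(2) by (metis not_less)
  then obtain j where j: "i = Suc j"
    using not0_implies_Suc by blast
  have less: "aleph j < \<kappa>"
    using not_less_Least[of j "\<lambda>i. \<kappa> \<le> aleph i"] j i_def by force
  then have "|{..<aleph j :: 'a}| <o |{..<\<kappa>}|"
    using assms(1) unfolding is_cardinal_def by blast
  then have "aleph (Suc j) \<le> \<kappa>"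
    unfolding aleph.simps(2) by (rule Least_le)
  then have eq: "\<kappa> = aleph (Suc j)"
    using i j by auto
  then have "j < m"
    using assms(3) aleph_strict_mono by (metis strict_mono_less Suc_less_eq)
  then show ?thesis
    using eq that by blast
qed

end

section \<open>Regular ordinals and the computation of \<open>cf\<close>\<close>

text \<open>Uncountability together with cofinality equal to the cardinality. This does not make
  \<open>\<kappa>\<close> a cardinal (the ordinal sum of two copies of \<open>aleph 1\<close> also
  qualifies), so \<open>is_cardinal\<close> is required separately where \<open>cf\<close> is
  computed.\<close>

definition regular_uncountable :: "'a::wellorder \<Rightarrow> bool" where
  "regular_uncountable \<kappa> \<longleftrightarrow> |UNIV :: nat set| <o |{..<\<kappa>}| \<and>
     (\<forall>B\<subseteq>{..<\<kappa>}. |B| <o |{..<\<kappa>}| \<longrightarrow> (\<exists>\<beta><\<kappa>. B \<subseteq> {..<\<beta>}))"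

lemma regular_uncountable_aleph_Suc:
  assumes "alephs_exist TYPE('a::wellorder)"
  shows "regular_uncountable (aleph (Suc n) :: 'a)"
  unfolding regular_uncountable_def ordLess_aleph_Suc_iff[OF assms]
proof (intro conjI allI impI)
  show "|UNIV :: nat set| \<le>o |{..<aleph n :: 'a}|"
    by (rule countable_ordLeq_aleph[OF assms])
  show "\<exists>\<beta><aleph (Suc n). B \<subseteq> {..<\<beta>}"
    if "B \<subseteq> {..<aleph (Suc n) :: 'a}" "|B| \<le>o |{..<aleph n :: 'a}|" for B
    using bounded_below_aleph_Suc[OF assms that] by blast
qed

lemma regular_uncountable_bounded:
  assumes "regular_uncountable \<kappa>" "B \<subseteq> {..<\<kappa>}" "|B| <o |{..<\<kappa>}|"
  obtains \<beta> where "\<beta> < \<kappa>" "B \<subseteq> {..<\<beta>}"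
  using assms unfolding regular_uncountable_def by blast

lemma regular_uncountable_finite_ordLess:
  assumes "regular_uncountable \<kappa>" "finite B"
  shows "|B| <o |{..<\<kappa>}|"
  using assms unfolding regular_uncountable_def
  by (meson finite_iff_ordLess_natLeq card_of_nat ordIso_symmetric ordLess_ordIso_trans ordLess_transitive)

lemma regular_uncountable_finite_bounded:
  assumes "regular_uncountable \<kappa>" "B \<subseteq> {..<\<kappa>}" "finite B"
  obtains \<beta> where "\<beta> < \<kappa>" "B \<subseteq> {..<\<beta>}"
  using assms regular_uncountable_bounded regular_uncountable_finite_ordLess by metis

lemma regular_uncountable_limit:
  assumes "regular_uncountable \<kappa>" "\<alpha> < \<kappa>"
  obtains \<beta> where "\<alpha> < \<beta>" "\<beta> < \<kappa>"
  using regular_uncountable_finite_bounded[OF assms(1), of "{\<alpha>}"] assms(2) by auto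

lemma regular_uncountable_countable_bounded:
  fixes b :: "nat \<Rightarrow> 'a::wellorder"
  assumes "regular_uncountable \<kappa>" "\<And>n. b n < \<kappa>"
  obtains \<beta> where "\<beta> < \<kappa>" "\<And>n. b n < \<beta>"
proof -
  have "|range b| <o |{..<\<kappa>}|"
    using assms card_of_image ordLeq_ordLess_trans unfolding regular_uncountable_def by blast
  then obtain \<beta> where "\<beta> < \<kappa>" "range b \<subseteq> {..<\<beta>}"
    using assms by (metis regular_uncountable_bounded image_subsetI lessThan_iff)
  then show ?thesis
    using that[of \<beta>] by auto
qed

text \<open>The range of \<open>\<eta>\<close> is cofinal, and no smaller set is: choosing for each
  member of a small cofinal \<open>y\<close> an index whose value lies beyond it gives indices
  bounded by some \<open>\<beta> < \<kappa>\<close>, and then no member of \<open>y\<close> reaches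
  \<open>\<eta> \<beta>\<close>.\<close>

lemma cf_eqI:
  fixes \<kappa> :: "'a::wellorder"
  assumes \<kappa>: "regular_uncountable \<kappa>" "is_cardinal \<kappa>"
    and \<eta>: "\<And>\<xi>. \<xi> < \<kappa> \<Longrightarrow> \<eta> \<xi> \<in> x" "\<And>\<xi> \<xi>'. \<xi> \<le> \<xi>' \<Longrightarrow> \<xi>' < \<kappa> \<Longrightarrow> \<eta> \<xi> \<le> \<eta> \<xi>'"
    and cofinal: "\<And>z. z \<in> x \<Longrightarrow> \<exists>\<xi><\<kappa>. z < \<eta> \<xi>"
  shows "cf x = \<kappa>"
proof -
  have ge: "|{..<\<kappa>}| \<le>o |y|" if y: "y \<subseteq> x" "\<forall>\<xi>\<in>x. \<exists>\<eta>\<in>y. \<xi> \<le> \<eta>" for y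
  proof (rule ccontr)
    assume "\<not> |{..<\<kappa>}| \<le>o |y|"
    then have less: "|y| <o |{..<\<kappa>}|"
      using not_ordLess_iff_ordLeq card_of_Well_order by blast
    have "\<forall>z\<in>y. \<exists>\<xi><\<kappa>. z < \<eta> \<xi>"
      using cofinal y(1) by blast
    then obtain f where f: "\<And>z. z \<in> y \<Longrightarrow> f z < \<kappa> \<and> z < \<eta> (f z)"
      by metis
    have "|f ` y| <o |{..<\<kappa>}|"
      using less card_of_image ordLeq_ordLess_trans by blast
    moreover have "f ` y \<subseteq> {..<\<kappa>}"
      using f by auto
    ultimately obtain \<beta> where \<beta>: "\<beta> < \<kappa>" "f ` y \<subseteq> {..<\<beta>}"
      using regular_uncountable_bounded[OF \<kappa>(1)] by blast
    then obtain z where z: "z \<in> y" "\<eta> \<beta> \<le> z"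
      using y(2) \<eta>(1) by blast
    then show False
      using f[OF z(1)] \<eta>(2)[of "f z" \<beta>] \<beta> by force
  qed
  show ?thesis
    unfolding cf_def
  proof (rule Least_equality)
    let ?y = "\<eta> ` {..<\<kappa>}"
    have sub: "?y \<subseteq> x"
      using \<eta>(1) by auto
    have cof: "\<forall>\<xi>\<in>x. \<exists>\<eta>\<in>?y. \<xi> \<le> \<eta>"
      using cofinal by (metis imageI lessThan_iff less_imp_le)
    \<comment> \<open>\<open>\<eta>\<close> need not be injective; the lower bound on its range is
      \<open>ge\<close> applied to that range.\<close>
    have "|?y| =o |{..<\<kappa>}|"
      using ge[OF sub cof] card_of_image[of \<eta> "{..<\<kappa>}"] ordIso_iff_ordLeq by blast
    then show "\<exists>y\<subseteq>x. (\<forall>\<xi>\<in>x. \<exists>\<eta>\<in>y. \<xi> \<le> \<eta>) \<and> |y| =o |{..<\<kappa>}|"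
      using sub cof by blast
  next
    fix \<alpha> :: 'a
    assume "\<exists>y\<subseteq>x. (\<forall>\<xi>\<in>x. \<exists>\<eta>\<in>y. \<xi> \<le> \<eta>) \<and> |y| =o |{..<\<alpha>}|"
    then have "|{..<\<kappa>}| \<le>o |{..<\<alpha>}|"
      using ge ordLeq_ordIso_trans by metis
    then show "\<kappa> \<le> \<alpha>"
      using \<kappa>(2) not_ordLess_ordLeq unfolding is_cardinal_def by (metis not_less)
  qed
qed


section \<open>Guessing short sequences below a regular cardinal\<close>

text \<open>Transfinite recursion as an equation: the hypothesis says that \<open>\<Phi>\<close>
  consults only values below the index.\<close>

lemma wellorder_recursion:
  fixes \<Phi> :: "'a::wellorder \<Rightarrow> ('a \<Rightarrow> 'b) \<Rightarrow> 'b"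
  assumes "\<And>f g \<xi>. (\<And>\<zeta>. \<zeta> < \<xi> \<Longrightarrow> f \<zeta> = g \<zeta>) \<Longrightarrow> \<Phi> \<xi> f = \<Phi> \<xi> g"
  obtains h where "\<And>\<xi>. h \<xi> = \<Phi> \<xi> h"
proof -
  define F where "F = (\<lambda>f \<xi>. \<Phi> \<xi> f)"
  have "adm_wf {(\<zeta>, \<xi>). \<zeta> < (\<xi> :: 'a)} F"
    unfolding adm_wf_def F_def using assms by blast
  then have "wfrec {(\<zeta>, \<xi>). \<zeta> < (\<xi> :: 'a)} F = F (wfrec {(\<zeta>, \<xi>). \<zeta> < \<xi>} F)"
    using wfrec_fixpoint[OF wf] by blast
  then show ?thesis
    using that[of "wfrec {(\<zeta>, \<xi>). \<zeta> < \<xi>} F"] unfolding F_def by metis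
qed

locale regular_cardinal = 
  fixes \<mu> :: "'b rel"
  assumes Cinfinite: "Cinfinite \<mu>" and regularCard: "regularCard \<mu>"
begin

definition less (infix "\<prec>" 50) where
  "x \<prec> y \<longleftrightarrow> (x, y) \<in> \<mu> \<and> x \<noteq> y"

lemma wo_rel: "wo_rel \<mu>"
  using Cinfinite unfolding wo_rel_def card_order_on_def by blast

lemma less_Field: "x \<prec> y \<Longrightarrow> x \<in> Field \<mu> \<and> y \<in> Field \<mu>"
  by (auto simp: Field_def less_def)

lemma less_trans: "x \<prec> y \<Longrightarrow> y \<prec> z \<Longrightarrow> x \<prec> z"
  using wo_rel.TRANS[OF wo_rel] wo_rel.ANTISYM[OF wo_rel] unfolding trans_def antisym_def less_def by metis

lemma less_irrefl: "\<not> x \<prec> x"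
  by (simp add: less_def)

lemma less_linear: "x \<in> Field \<mu> \<Longrightarrow> y \<in> Field \<mu> \<Longrightarrow> x \<prec> y \<or> x = y \<or> y \<prec> x"
  using wo_rel.TOTALS[OF wo_rel] unfolding less_def by blast

lemma le_less_trans: "x = y \<or> x \<prec> y \<Longrightarrow> y \<prec> z \<Longrightarrow> x \<prec> z"
  using less_trans by blast

text \<open>\<open>regularCard\<close> says that cofinal sets have full size. A small set is
  therefore not cofinal, hence weakly below some \<open>a\<close>; as \<open>\<mu>\<close> has no
  last element, a further \<open>a'\<close> makes the bound strict.\<close>

lemma strictly_bounded:
  assumes "B \<subseteq> Field \<mu>" "|B| <o \<mu>"
  obtains a where "a \<in> Field \<mu>" "\<And>b. b \<in> B \<Longrightarrow> b \<prec> a"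
proof -
  have "\<not> cofinal B \<mu>"
    using assms regularCard not_ordLess_ordIso unfolding regularCard_def by blast
  then obtain a where a: "a \<in> Field \<mu>" "\<forall>b\<in>B. \<not> a \<prec> b"
    unfolding cofinal_def less_def by blast
  obtain a' where a': "a' \<in> Field \<mu>" "a \<prec> a'"
    using infinite_Card_order_limit[of \<mu> a] Cinfinite a(1) unfolding cinfinite_def less_def by blast
  have "b \<prec> a'" if "b \<in> B" for b
  proof -
    have "b = a \<or> b \<prec> a"
      using that a assms(1) less_linear[of b a] by blast
    then show ?thesis
      using a'(2) le_less_trans by blast
  qed
  then show ?thesis
    using a'(1) by (rule that[rotated])
qed

text \<open>\<open>wo_rel.suc\<close> is the least strict upper bound; for sets smaller than
  \<open>\<mu>\<close> it exists by regularity.\<close>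

definition ssup :: "'b set \<Rightarrow> 'b" where
  "ssup B = wo_rel.suc \<mu> B"

lemma AboveS_nonempty:
  assumes "B \<subseteq> Field \<mu>" "|B| <o \<mu>"
  shows "AboveS \<mu> B \<noteq> {}"
proof -
  obtain a where "a \<in> Field \<mu>" "\<And>b. b \<in> B \<Longrightarrow> b \<prec> a"
    using strictly_bounded[OF assms] by blast
  then have "a \<in> AboveS \<mu> B"
    unfolding AboveS_def less_def by blast
  then show ?thesis
    by blast
qed

lemma ssup_Field: "B \<subseteq> Field \<mu> \<Longrightarrow> |B| <o \<mu> \<Longrightarrow> ssup B \<in> Field \<mu>"
  unfolding ssup_def using wo_rel.suc_inField[OF wo_rel] AboveS_nonempty by blast

lemma ssup_greater:
  assumes "B \<subseteq> Field \<mu>" "|B| <o \<mu>" "b \<in> B"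
  shows "b \<prec> ssup B"
  using wo_rel.suc_greater[OF wo_rel assms(1) AboveS_nonempty[OF assms(1,2)] assms(3)]
  unfolding ssup_def less_def by blast

lemma less_ssupE:
  assumes "B \<subseteq> Field \<mu>" "|B| <o \<mu>" "a \<prec> ssup B"
  obtains b where "b \<in> B" "a = b \<or> a \<prec> b"
proof (rule ccontr)
  assume contra: "\<not> thesis"
  have "b \<prec> a" if "b \<in> B" for b
    using contra \<open>\<And>b. b \<in> B \<Longrightarrow> a = b \<or> a \<prec> b \<Longrightarrow> thesis\<close>[OF that] less_linear[of a b]
      less_Field[OF assms(3)] assms(1) that by blast
  then have "a \<in> AboveS \<mu> B"
    using less_Field[OF assms(3)] unfolding AboveS_def less_def by blast
  then have "(ssup B, a) \<in> \<mu>"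
    unfolding ssup_def by (rule wo_rel.suc_least_AboveS[OF wo_rel])
  then show False
    using assms(3) wo_rel.ANTISYM[OF wo_rel] unfolding less_def antisym_def by blast
qed

text \<open>A normal sequence: strictly increasing and continuous at limits. The least index
  satisfies the limit condition vacuously, so its value has to be the least element of
  \<open>Field \<mu>\<close>.\<close>

definition continuous_seq :: "'a::wellorder \<Rightarrow> ('a \<Rightarrow> 'b) \<Rightarrow> bool" where
  "continuous_seq \<kappa> f \<longleftrightarrow> (\<forall>\<xi><\<kappa>. f \<xi> \<in> Field \<mu>) \<and> (\<forall>\<xi><\<kappa>. \<forall>\<zeta><\<xi>. f \<zeta> \<prec> f \<xi>) \<and>
     (\<forall>\<xi><\<kappa>. (\<forall>\<zeta><\<xi>. \<exists>\<zeta>'<\<xi>. \<zeta> < \<zeta>') \<longrightarrow> (\<forall>a. a \<prec> f \<xi> \<longrightarrow> (\<exists>\<zeta><\<xi>. a \<prec> f \<zeta>)))"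

definition converges_to :: "'a::wellorder \<Rightarrow> ('a \<Rightarrow> 'b) \<Rightarrow> 'b \<Rightarrow> bool" where
  "converges_to \<kappa> f \<eta> \<longleftrightarrow> (\<forall>\<xi><\<kappa>. f \<xi> \<prec> \<eta>) \<and> (\<forall>a. a \<prec> \<eta> \<longrightarrow> (\<exists>\<xi><\<kappa>. a \<prec> f \<xi>))"

lemma continuous_seq_mono: "continuous_seq \<kappa> f \<Longrightarrow> \<zeta> \<le> \<xi> \<Longrightarrow> \<xi> < \<kappa> \<Longrightarrow> f \<zeta> = f \<xi> \<or> f \<zeta> \<prec> f \<xi>"
  unfolding continuous_seq_def by (metis order_le_less)

text \<open>Two normal sequences with the same supremum have club ranges in it. Interleaving them
  along countably many indices leads to an index below which both have the same supremum, and
  continuity makes the values equal there.\<close>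

lemma continuous_seqs_agree:
  fixes \<kappa> :: "'a::wellorder"
  assumes \<kappa>: "regular_uncountable \<kappa>"
    and f: "continuous_seq \<kappa> f" "converges_to \<kappa> f \<eta>"
    and g: "continuous_seq \<kappa> g" "converges_to \<kappa> g \<eta>"
    and "\<xi>0 < \<kappa>"
  obtains \<xi> where "\<xi>0 \<le> \<xi>" "\<xi> < \<kappa>" "f \<xi> = g \<xi>"
proof -
  have step: "\<exists>\<xi>'. \<xi>' < \<kappa> \<and> \<xi> < \<xi>' \<and> f \<xi> \<prec> g \<xi>' \<and> g \<xi> \<prec> f \<xi>'" if \<xi>: "\<xi> < \<kappa>" for \<xi>
  proof -
    obtain a b where a: "a < \<kappa>" "f \<xi> \<prec> g a" and b: "b < \<kappa>" "g \<xi> \<prec> f b"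
      using f(2) g(2) \<xi> unfolding converges_to_def by blast
    obtain \<xi>' where \<xi>': "\<xi>' < \<kappa>" "{\<xi>, a, b} \<subseteq> {..<\<xi>'}"
      using regular_uncountable_finite_bounded[OF \<kappa>, of "{\<xi>, a, b}"] \<xi> a b by auto
    then have "f \<xi> \<prec> g \<xi>'" "g \<xi> \<prec> f \<xi>'"
      using a b less_trans continuous_seq_mono[OF g(1), of a \<xi>'] continuous_seq_mono[OF f(1), of b \<xi>']
      by (metis insert_subset lessThan_iff less_imp_le)+
    then show ?thesis
      using \<xi>' by auto
  qed
  obtain s where s': "\<And>n::nat. s n < \<kappa> \<and> (n = 0 \<longrightarrow> s n = \<xi>0)"
    and s_Suc: "\<And>n. s n < s (Suc n) \<and> f (s n) \<prec> g (s (Suc n)) \<and> g (s n) \<prec> f (s (Suc n))"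
    using dependent_nat_choice[of "\<lambda>n \<xi>. \<xi> < \<kappa> \<and> (n = 0 \<longrightarrow> \<xi> = \<xi>0)"
        "\<lambda>_ \<xi> \<xi>'. \<xi> < \<xi>' \<and> f \<xi> \<prec> g \<xi>' \<and> g \<xi> \<prec> f \<xi>'"] step assms(6)
    by (metis Zero_not_Suc)
  have s0: "s 0 = \<xi>0" and s: "s n < \<kappa>" for n
    using s' by blast+
  \<comment> \<open>The supremum of the \<open>s n\<close>. It lies below \<open>\<kappa>\<close>
    because countable sets are bounded, and it is a limit, so both sequences are continuous at
    it.\<close>
  define \<xi> where "\<xi> = (LEAST \<beta>. \<forall>n. s n < \<beta>)"
  obtain \<beta> where \<beta>: "\<beta> < \<kappa>" "\<And>n. s n < \<beta>"
    using regular_uncountable_countable_bounded[OF \<kappa>, of s] s by metis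
  have s_less: "s n < \<xi>" for n
    unfolding \<xi>_def using LeastI[of "\<lambda>\<beta>. \<forall>n. s n < \<beta>" \<beta>] \<beta>(2) by blast
  have \<xi>: "\<xi> < \<kappa>"
    unfolding \<xi>_def using Least_le[of "\<lambda>\<beta>. \<forall>n. s n < \<beta>" \<beta>] \<beta> by (metis order_le_less_trans)
  have s_cofinal: "\<exists>n. \<zeta> \<le> s n" if "\<zeta> < \<xi>" for \<zeta>
    using not_less_Least[OF that[unfolded \<xi>_def]] by (meson not_less)
  have limit: "\<forall>\<zeta><\<xi>. \<exists>\<zeta>'<\<xi>. \<zeta> < \<zeta>'"
    using s_cofinal s_less s_Suc by (meson order_le_less_trans)
  \<comment> \<open>By continuity, a \<open>v \<xi>\<close> above \<open>u \<xi>\<close> would have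
    \<open>u \<xi>\<close> below \<open>v (s n)\<close> for some \<open>n\<close>, but
    \<open>u\<close> passes that value at the next step. This is used in both directions.\<close>
  have not_less: "\<not> u \<xi> \<prec> v \<xi>"
    if u: "continuous_seq \<kappa> u" and v: "continuous_seq \<kappa> v" and vu: "\<And>n. v (s n) \<prec> u (s (Suc n))" for u v
  proof
    assume "u \<xi> \<prec> v \<xi>"
    then obtain \<zeta> where \<zeta>: "\<zeta> < \<xi>" "u \<xi> \<prec> v \<zeta>"
      using v \<xi> limit unfolding continuous_seq_def by blast
    then obtain n where "\<zeta> \<le> s n"
      using s_cofinal by blast
    then have "u \<xi> \<prec> v (s n)"
      using \<zeta>(2) continuous_seq_mono[OF v _ s] less_trans by metis
    then have "u \<xi> \<prec> u (s (Suc n))"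
      using vu less_trans by blast
    moreover have "u (s (Suc n)) \<prec> u \<xi>"
      using u \<xi> s_less unfolding continuous_seq_def by blast
    ultimately show False
      using less_trans less_irrefl by blast
  qed
  have "f \<xi> = g \<xi>"
    using not_less[OF f(1) g(1)] not_less[OF g(1) f(1)] s_Suc \<xi> f(1) g(1) less_linear[of "f \<xi>" "g \<xi>"]
    unfolding continuous_seq_def by blast
  moreover have "\<xi>0 \<le> \<xi>"
    using s_less[of 0] s0 by simp
  ultimately show ?thesis
    using \<xi> that by blast
qed

text \<open>Each value is the least strict bound of the earlier values and of the demands
  \<open>g\<close> makes on earlier initial parts. The demands do not spoil continuity: at a limit
  each of them has been passed at an earlier index.\<close>

lemma growing_continuous_seq:
  fixes \<kappa> :: "'a::wellorder"
  assumes "|{..<\<kappa>}| <o \<mu>" and \<kappa>: "\<forall>\<zeta><\<kappa>. \<exists>\<zeta>'<\<kappa>. \<zeta> < \<zeta>'" and g: "range g \<subseteq> Field \<mu>"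
  obtains h \<eta> where "continuous_seq \<kappa> h" "\<eta> \<in> Field \<mu>" "converges_to \<kappa> h \<eta>"
    "\<forall>\<xi><\<kappa>. \<forall>\<zeta><\<xi>. g (h ` {..\<zeta>}) \<prec> h \<xi>"
proof -
  define B where "B = (\<lambda>(h :: 'a \<Rightarrow> 'b) \<xi>. h ` {..<\<xi>} \<union> (\<lambda>\<zeta>. g (h ` {..\<zeta>})) ` {..<\<xi>})"
  have "B f \<xi> = B h \<xi>" if "\<And>\<zeta>. \<zeta> < \<xi> \<Longrightarrow> f \<zeta> = h \<zeta>" for f h \<xi>
  proof -
    have "f ` {..<\<xi>} = h ` {..<\<xi>}"
      using that by (intro image_cong) auto
    moreover have "f ` {..\<zeta>} = h ` {..\<zeta>}" if "\<zeta> < \<xi>" for \<zeta>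
      using that \<open>\<And>\<zeta>. \<zeta> < \<xi> \<Longrightarrow> f \<zeta> = h \<zeta>\<close> by (intro image_cong) auto
    ultimately show ?thesis
      unfolding B_def by auto
  qed
  then obtain h where h: "\<And>\<xi>. h \<xi> = ssup (B h \<xi>)"
    using wellorder_recursion[of "\<lambda>\<xi> h. ssup (B h \<xi>)"] by metis
  have B_card: "|B h \<xi>| <o \<mu>" if "\<xi> \<le> \<kappa>" for \<xi>
  proof -
    have "|{..<\<xi>}| <o \<mu>"
      using that assms(1) by (meson card_of_mono1 lessThan_subset_iff ordLeq_ordLess_trans)
    then have "|f ` {..<\<xi>}| <o \<mu>" for f :: "'a \<Rightarrow> 'b"
      using card_of_image ordLeq_ordLess_trans by blast
    then show ?thesis
      unfolding B_def using Un_Cinfinite_bound_strict Cinfinite by blast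
  qed
  have Field: "h \<xi> \<in> Field \<mu>" if "\<xi> \<le> \<kappa>" for \<xi>
    using that
  proof (induction \<xi> rule: less_induct)
    case (less \<xi>)
    have "h \<zeta> \<in> Field \<mu>" if "\<zeta> < \<xi>" for \<zeta>
      using less that by force
    then have "B h \<xi> \<subseteq> Field \<mu>"
      unfolding B_def using g by auto
    then show ?case
      using h ssup_Field B_card less.prems by metis
  qed
  then have B_Field: "B h \<xi> \<subseteq> Field \<mu>" if "\<xi> \<le> \<kappa>" for \<xi>
    unfolding B_def using that g by auto
  have mono: "h \<zeta> \<prec> h \<xi>" and growth: "g (h ` {..\<zeta>}) \<prec> h \<xi>" if "\<zeta> < \<xi>" "\<xi> \<le> \<kappa>" for \<zeta> \<xi>
  proof -
    have "h \<zeta> \<in> B h \<xi>" "g (h ` {..\<zeta>}) \<in> B h \<xi>"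
      using that unfolding B_def by auto
    then show "h \<zeta> \<prec> h \<xi>" "g (h ` {..\<zeta>}) \<prec> h \<xi>"
      using ssup_greater[OF B_Field B_card] that(2) h[of \<xi>] by metis+
  qed
  have limit: "\<exists>\<zeta><\<xi>. a \<prec> h \<zeta>"
    if \<xi>: "\<xi> \<le> \<kappa>" "\<forall>\<zeta><\<xi>. \<exists>\<zeta>'<\<xi>. \<zeta> < \<zeta>'" "a \<prec> h \<xi>" for a \<xi>
  proof -
    obtain b where b: "b \<in> B h \<xi>" "a = b \<or> a \<prec> b"
      using less_ssupE[OF B_Field[OF \<xi>(1)] B_card[OF \<xi>(1)]] \<xi>(3) h[of \<xi>] by metis
    then obtain \<zeta> where "\<zeta> < \<xi>" "b = h \<zeta> \<or> b = g (h ` {..\<zeta>})"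
      unfolding B_def by auto
    moreover from this obtain \<zeta>' where \<zeta>': "\<zeta>' < \<xi>" "\<zeta> < \<zeta>'"
      using \<xi>(2) by blast
    ultimately have "b \<prec> h \<zeta>'"
      using mono[of \<zeta> \<zeta>'] growth[of \<zeta> \<zeta>'] \<xi>(1) by auto
    then show ?thesis
      using b(2) le_less_trans \<zeta>'(1) by blast
  qed
  have "continuous_seq \<kappa> h"
    unfolding continuous_seq_def using Field mono limit by (meson less_imp_le)
  \<comment> \<open>The recursion runs one step beyond the sequence: since \<open>\<kappa>\<close>
    is a limit, \<open>h \<kappa>\<close> is the supremum of the values before it.\<close>
  moreover have "converges_to \<kappa> h (h \<kappa>)"
    unfolding converges_to_def using mono limit \<kappa> by blast
  ultimately show ?thesis
    using that[of h "h \<kappa>"] Field[of \<kappa>] growth by simp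
qed

text \<open>The order of quantifiers matters: \<open>\<P>\<close> is fixed before the demand
  \<open>g\<close> is known. The sequence \<open>h\<close> may leave \<open>C\<close>, but it visits
  \<open>C\<close> cofinally often and outgrows the demands made by its initial parts.\<close>

definition guessing :: "'a::wellorder \<Rightarrow> 'b set set \<Rightarrow> bool" where
  "guessing \<kappa> \<P> \<longleftrightarrow> (\<forall>g. range g \<subseteq> Field \<mu> \<longrightarrow>
     (\<exists>C\<in>\<P>. \<exists>h. (\<forall>\<xi><\<kappa>. h \<xi> \<in> Field \<mu>) \<and>
       (\<forall>\<xi><\<kappa>. \<exists>\<xi>'<\<kappa>. \<xi> \<le> \<xi>' \<and> h \<xi>' \<in> C) \<and> (\<forall>\<xi><\<kappa>. \<forall>\<zeta><\<xi>. g (h ` {..\<zeta>}) \<prec> h \<xi>)))"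

text \<open>
  One club is fixed in advance for each possible supremum \<open>\<eta>\<close>.  A growing continuous sequence is built
  knowing nothing about these clubs, but its range meets the club attached to its own supremum
  cofinally, because two clubs in an ordinal of uncountable cofinality meet.
\<close>

lemma guessing_family:
  fixes \<kappa> :: "'a::wellorder"
  assumes \<kappa>: "regular_uncountable \<kappa>" "|{..<\<kappa>}| <o \<mu>"
  obtains \<P> where "|\<P>| \<le>o \<mu>" "\<And>C. C \<in> \<P> \<Longrightarrow> C \<subseteq> Field \<mu> \<and> |C| \<le>o |{..<\<kappa>}|"
    "guessing \<kappa> \<P>"
proof -
  define c where "c = (\<lambda>\<eta>. SOME f. continuous_seq \<kappa> f \<and> converges_to \<kappa> f \<eta>)"
  define L where "L = {\<eta> \<in> Field \<mu>. \<exists>f. continuous_seq \<kappa> f \<and> converges_to \<kappa> f \<eta>}"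
  have c: "continuous_seq \<kappa> (c \<eta>)" "converges_to \<kappa> (c \<eta>) \<eta>" if "\<eta> \<in> L" for \<eta>
    using that someI_ex[of "\<lambda>f. continuous_seq \<kappa> f \<and> converges_to \<kappa> f \<eta>"] unfolding c_def L_def by blast+
  define \<P> where "\<P> = (\<lambda>\<eta>. c \<eta> ` {..<\<kappa>}) ` L"
  have "|L| \<le>o |Field \<mu>|"
    unfolding L_def by (intro card_of_mono1) auto
  then have "|L| \<le>o \<mu>"
    using card_of_Field_ordIso Cinfinite ordLeq_ordIso_trans by blast
  then have 1: "|\<P>| \<le>o \<mu>"
    unfolding \<P>_def using card_of_image ordLeq_transitive by blast
  have 2: "C \<subseteq> Field \<mu> \<and> |C| \<le>o |{..<\<kappa>}|" if C: "C \<in> \<P>" for C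
  proof -
    obtain \<eta> where "\<eta> \<in> L" "C = c \<eta> ` {..<\<kappa>}"
      using C unfolding \<P>_def by blast
    then show ?thesis
      using c(1)[of \<eta>] card_of_image unfolding continuous_seq_def by auto
  qed
  have "\<exists>C\<in>\<P>. \<exists>h. (\<forall>\<xi><\<kappa>. h \<xi> \<in> Field \<mu>) \<and>
       (\<forall>\<xi><\<kappa>. \<exists>\<xi>'<\<kappa>. \<xi> \<le> \<xi>' \<and> h \<xi>' \<in> C) \<and> (\<forall>\<xi><\<kappa>. \<forall>\<zeta><\<xi>. g (h ` {..\<zeta>}) \<prec> h \<xi>)"
    if g: "range g \<subseteq> Field \<mu>" for g
  proof -
    have limit: "\<forall>\<zeta><\<kappa>. \<exists>\<zeta>'<\<kappa>. \<zeta> < \<zeta>'"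
      using regular_uncountable_limit[OF \<kappa>(1)] by metis
    obtain h \<eta> where h: "continuous_seq \<kappa> h" "\<eta> \<in> Field \<mu>" "converges_to \<kappa> h \<eta>"
      and growth: "\<forall>\<xi><\<kappa>. \<forall>\<zeta><\<xi>. g (h ` {..\<zeta>}) \<prec> h \<xi>"
      using growing_continuous_seq[OF \<kappa>(2) limit g] .
    have \<eta>: "\<eta> \<in> L"
      unfolding L_def using h by blast
    have "\<exists>\<xi>'<\<kappa>. \<xi> \<le> \<xi>' \<and> h \<xi>' \<in> c \<eta> ` {..<\<kappa>}" if \<xi>: "\<xi> < \<kappa>" for \<xi>
    proof -
      obtain \<xi>' where \<xi>': "\<xi> \<le> \<xi>'" "\<xi>' < \<kappa>" "h \<xi>' = c \<eta> \<xi>'"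
        using continuous_seqs_agree[OF \<kappa>(1) h(1,3) c[OF \<eta>] \<xi>] .
      then show ?thesis
        by auto
    qed
    moreover have "\<forall>\<xi><\<kappa>. h \<xi> \<in> Field \<mu>"
      using h(1) unfolding continuous_seq_def by blast
    moreover have "c \<eta> ` {..<\<kappa>} \<in> \<P>"
      using \<eta> unfolding \<P>_def by blast
    ultimately show ?thesis
      using growth by blast
  qed
  then have "guessing \<kappa> \<P>"
    unfolding guessing_def by blast
  with 1 2 show ?thesis
    by (rule that)
qed

end


section \<open>Finitary hulls from clubs\<close>

text \<open>Finite subsets are layered by the number of insertions; there are countably many layers,
  each with at most \<open>aleph k\<close> members.\<close>

lemma finite_subsets_ordLeq_aleph:
  assumes alephs: "alephs_exist TYPE('a::wellorder)" and X: "|X| \<le>o |{..<aleph k :: 'a}|"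
  shows "|{s. s \<subseteq> X \<and> finite s}| \<le>o |{..<aleph k :: 'a}|"
proof -
  define S where "S = rec_nat {{}} (\<lambda>_ T. \<Union>x\<in>X. insert x ` T)"
  have S_0: "S 0 = {{}}" and S_Suc: "S (Suc n) = (\<Union>x\<in>X. insert x ` S n)" for n
    unfolding S_def by simp_all
  have card_S: "|S n| \<le>o |{..<aleph k :: 'a}|" for n
  proof (induction n)
    case 0
    show ?case
      unfolding S_0 by (rule finite_ordLeq_aleph[OF alephs]) simp
  next
    case (Suc n)
    show ?case
      unfolding S_Suc using X image_ordLeq[OF alephs Suc] by (intro UN_ordLeq_aleph[OF alephs])
  qed
  have "s \<in> \<Union> (range S)" if "finite s" "s \<subseteq> X" for s
    using that
  proof (induction s)
    case empty
    show ?case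
      using S_0 by blast
  next
    case (insert x s)
    then obtain n where "s \<in> S n"
      by auto
    then have "insert x s \<in> S (Suc n)"
      unfolding S_Suc using insert.prems by blast
    then show ?case
      by blast
  qed
  then have "{s. s \<subseteq> X \<and> finite s} \<subseteq> (\<Union>n. S n)"
    by blast
  moreover have "|\<Union>n. S n| \<le>o |{..<aleph k :: 'a}|"
    using countable_ordLeq_aleph[OF alephs] card_S by (intro UN_ordLeq_aleph[OF alephs])
  ultimately show ?thesis
    using card_of_mono1 ordLeq_transitive by blast
qed

text \<open>
  The hull need not be idempotent: only monotonicity, finite character and the size bound are used.
\<close>

locale finitary_hull =
  fixes cl :: "'a::wellorder set \<Rightarrow> 'a set" and m :: nat
  assumes alephs: "alephs_exist TYPE('a)"
    and cl_mono: "X \<subseteq> Y \<Longrightarrow> cl X \<subseteq> cl Y"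
    and cl_extensive: "X \<subseteq> aleph_omega \<Longrightarrow> X \<subseteq> cl X"
    and cl_finitary: "z \<in> cl X \<Longrightarrow> \<exists>s\<subseteq>X. finite s \<and> z \<in> cl s"
    and cl_card: "X \<subseteq> aleph_omega \<Longrightarrow> m \<le> k \<Longrightarrow> |X| \<le>o |{..<aleph k :: 'a}|
      \<Longrightarrow> |cl X| \<le>o |{..<aleph k :: 'a}|"

text \<open>Stage \<open>Suc n\<close> absorbs the stage \<open>n\<close> values of all subsets of
  \<open>s\<close>. Evaluating a finite set at the stage given by its cardinality makes the values
  monotone in the set, while each of them is still a value of \<open>p\<close>.\<close>

primrec closing :: "('a set \<Rightarrow> 'a set) \<Rightarrow> nat \<Rightarrow> 'a set \<Rightarrow> 'a set" where
  "closing p 0 s = p s"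
| "closing p (Suc n) s = p (s \<union> (\<Union>t\<in>Pow s. closing p n t))"

text \<open>Finite sets are mapped monotonically into \<open>C\<close>, and the hull of
  \<open>X\<close> is the directed union of the values at its finite subsets. Closure of
  \<open>C\<close> is available for chains only, so membership in \<open>C\<close> is proved by
  induction on \<open>|X|\<close>.\<close>

lemma club_finitary_hull:
  assumes alephs: "alephs_exist TYPE('a::wellorder)"
    and club: "club_in C (aleph_omega :: 'a set) |{..<aleph (Suc m) :: 'a}|"
  obtains cl where "finitary_hull cl m"
    "\<And>X. X \<subseteq> aleph_omega \<Longrightarrow> |X| \<le>o |{..<aleph m :: 'a}| \<Longrightarrow> cl X \<in> C"
proof -
  let ?W = "aleph_omega :: 'a set"
  let ?S = "{x. x \<subseteq> ?W \<and> |x| \<le>o |{..<aleph m :: 'a}| }"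
  have small: "subsets_lt ?W |{..<aleph (Suc m) :: 'a}| = ?S"
    unfolding subsets_lt_def ordLess_aleph_Suc_iff[OF alephs] ..
  have C: "C \<subseteq> ?S" and C_cofinal: "\<And>x. x \<in> ?S \<Longrightarrow> \<exists>y\<in>C. x \<subseteq> y"
    and C_closed: "\<And>\<C>. subset.chain C \<C> \<Longrightarrow> \<C> \<noteq> {} \<Longrightarrow> |\<C>| \<le>o |{..<aleph m :: 'a}| \<Longrightarrow> \<Union>\<C> \<in> C"
    using club unfolding club_in_def small ordLess_aleph_Suc_iff[OF alephs] by blast+
  define p where "p = (\<lambda>x. SOME y. y \<in> C \<and> x \<subseteq> y)"
  have p: "p x \<in> C" "x \<subseteq> p x" if "x \<in> ?S" for x
    using someI_ex[of "\<lambda>y. y \<in> C \<and> x \<subseteq> y"] C_cofinal[OF that] unfolding p_def by blast+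
  define G where "G = (\<lambda>s. closing p (card s) s)"
  have closing: "closing p n s \<in> C \<and> s \<subseteq> closing p n s" and
    closing_arg: "s \<union> (\<Union>t\<in>Pow s. closing p n t) \<in> ?S" if "finite s" "s \<subseteq> ?W" for n s
  proof -
    have s: "s \<in> ?S" if "finite s" "s \<subseteq> ?W" for s
      using that finite_ordLeq_aleph[OF alephs] by blast
    have arg: "s \<union> (\<Union>t\<in>Pow s. closing p n t) \<in> ?S" if fin: "finite s" "s \<subseteq> ?W"
      and IH: "\<And>t. finite t \<Longrightarrow> t \<subseteq> ?W \<Longrightarrow> closing p n t \<in> C" for n s
    proof -
      have "closing p n t \<in> ?S" if "t \<in> Pow s" for t
        using that fin IH[of t] C by (auto dest: finite_subset)
      moreover have "|Pow s| \<le>o |{..<aleph m :: 'a}|"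
        using fin(1) by (intro finite_ordLeq_aleph[OF alephs]) simp
      ultimately have "|\<Union>t\<in>Pow s. closing p n t| \<le>o |{..<aleph m :: 'a}|"
        "(\<Union>t\<in>Pow s. closing p n t) \<subseteq> ?W"
        using UN_ordLeq_aleph[OF alephs] by blast+
      then show ?thesis
        using s[OF fin] Un_ordLeq_aleph[OF alephs] by blast
    qed
    have *: "closing p n s \<in> C \<and> s \<subseteq> closing p n s" if "finite s" "s \<subseteq> ?W" for n s
      using that
    proof (induction n arbitrary: s)
      case 0
      then show ?case
        using p[OF s] by simp
    next
      case (Suc n)
      then have "s \<union> (\<Union>t\<in>Pow s. closing p n t) \<in> ?S"
        by (intro arg) auto
      then show ?case
        using p[of "s \<union> (\<Union>t\<in>Pow s. closing p n t)"] by auto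
    qed
    then show "closing p n s \<in> C \<and> s \<subseteq> closing p n s"
      using that by blast
    show "s \<union> (\<Union>t\<in>Pow s. closing p n t) \<in> ?S"
      using that * by (intro arg) auto
  qed
  have closing_step: "closing p n t \<subseteq> closing p (Suc n) s" if "finite s" "s \<subseteq> ?W" "t \<subseteq> s" for n s t
  proof -
    have "closing p n t \<subseteq> s \<union> (\<Union>t\<in>Pow s. closing p n t)"
      using that(3) by blast
    also have "\<dots> \<subseteq> closing p (Suc n) s"
      using p(2)[OF closing_arg[OF that(1,2)]] by simp
    finally show ?thesis .
  qed
  have closing_mono: "closing p n s \<subseteq> closing p k s" if "finite s" "s \<subseteq> ?W" "n \<le> k" for n k s
    using that(3) by (rule lift_Suc_mono_le[rotated]) (rule closing_step[OF that(1,2) subset_refl])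
  have G: "G s \<in> C" "s \<subseteq> G s" if "finite s" "s \<subseteq> ?W" for s
    using closing that unfolding G_def by blast+
  have G_mono: "G t \<subseteq> G s" if "finite s" "s \<subseteq> ?W" "t \<subseteq> s" for s t
  proof (cases "t = s")
    case False
    then have "card t < card s"
      using that psubset_card_mono by blast
    then have "closing p (Suc (card t)) s \<subseteq> closing p (card s) s"
      using closing_mono[OF that(1,2)] by (simp only: Suc_le_eq)
    then show ?thesis
      unfolding G_def using closing_step[OF that] by blast
  qed simp
  \<comment> \<open>Intersecting with \<open>?W\<close> ensures that \<open>G\<close> is applied
    only to sets where its values are known to lie in \<open>C\<close>.\<close>
  define cl where "cl = (\<lambda>X. \<Union>s\<in>{s. s \<subseteq> X \<inter> ?W \<and> finite s}. G s)"
  have cl_finite: "cl X = G X" if "finite X" "X \<subseteq> ?W" for X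
    using G_mono[OF that] that unfolding cl_def by blast
  have hull: "finitary_hull cl m"
  proof
    show "alephs_exist TYPE('a)"
      by (rule alephs)
    show "cl X \<subseteq> cl Y" if "X \<subseteq> Y" for X Y
      using that unfolding cl_def by blast
    show "X \<subseteq> cl X" if X: "X \<subseteq> ?W" for X
    proof
      fix x assume "x \<in> X"
      then show "x \<in> cl X"
        using G(2)[of "{x}"] X unfolding cl_def by blast
    qed
    show "\<exists>s\<subseteq>X. finite s \<and> z \<in> cl s" if "z \<in> cl X" for z X
    proof -
      obtain s where "s \<subseteq> X \<inter> ?W" "finite s" "z \<in> G s"
        using \<open>z \<in> cl X\<close> unfolding cl_def by blast
      then show ?thesis
        using cl_finite[of s] by blast
    qed
    show "|cl X| \<le>o |{..<aleph k :: 'a}|" if X: "X \<subseteq> ?W" "m \<le> k" "|X| \<le>o |{..<aleph k :: 'a}|" for X k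
      unfolding cl_def
    proof (rule UN_ordLeq_aleph[OF alephs])
      have "X \<inter> ?W = X"
        using X(1) by blast
      then show "|{s. s \<subseteq> X \<inter> ?W \<and> finite s}| \<le>o |{..<aleph k :: 'a}|"
        using finite_subsets_ordLeq_aleph[OF alephs X(3)] by simp
      show "|G s| \<le>o |{..<aleph k :: 'a}|" if "s \<in> {s. s \<subseteq> X \<inter> ?W \<and> finite s}" for s
        using G(1)[of s] that C ordLeq_aleph_trans[OF alephs _ X(2)] by blast
    qed
  qed
  have "cl X \<in> C" if "X \<subseteq> ?W" "|X| \<le>o |{..<aleph m :: 'a}|" for X
    using that
  proof (induction "|X|" arbitrary: X rule: wf_induct_rule[OF wf_ordLess])
    case (1 X)
    show ?case
    proof (cases "finite X")
      case True
      then show ?thesis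
        using G(1) cl_finite 1 by metis
    next
      case False
      let ?r = "|X|"
      have Field: "Field ?r = X"
        by (rule Field_card_of)
      \<comment> \<open>Proper initial segments of the cardinal order of \<open>X\<close> have
        smaller cardinality, so their hulls lie in \<open>C\<close> by induction; by monotonicity
        they form a chain.\<close>
      define \<C> where "\<C> = (\<lambda>x. cl (underS ?r x)) ` X"
      have under_sub: "underS ?r x \<subseteq> X" for x
        using Field by (auto simp: underS_def dest: FieldI1)
      have under_less: "|underS ?r x| <o |X|" if "x \<in> X" for x
        using card_of_underS[of ?r x] card_of_Card_order that Field by blast
      have "\<C> \<subseteq> C"
      proof -
        have "cl (underS ?r x) \<in> C" if "x \<in> X" for x
          using 1(1)[OF under_less[OF that]] under_sub[of x] 1(2,3) under_less[OF that]
          by (meson ordLess_imp_ordLeq ordLeq_transitive subset_trans)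
        then show ?thesis
          unfolding \<C>_def by blast
      qed
      moreover have "cl (underS ?r x) \<subseteq> cl (underS ?r y) \<or> cl (underS ?r y) \<subseteq> cl (underS ?r x)"
        if "x \<in> X" "y \<in> X" for x y
      proof -
        have wo: "wo_rel ?r"
          using card_of_Well_order unfolding wo_rel_def .
        have "underS ?r x \<subseteq> underS ?r y \<or> underS ?r y \<subseteq> underS ?r x"
          by (rule wo_rel.ofilter_linord[OF wo wo_rel.underS_ofilter[OF wo] wo_rel.underS_ofilter[OF wo]])
        then show ?thesis
          using finitary_hull.cl_mono[OF hull] by blast
      qed
      ultimately have "subset.chain C \<C>"
        unfolding subset_chain_def \<C>_def by blast
      moreover have "\<C> \<noteq> {}"
        using False unfolding \<C>_def by auto
      moreover have "|\<C>| \<le>o |{..<aleph m :: 'a}|"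
        unfolding \<C>_def using 1(3) image_ordLeq[OF alephs] by blast
      ultimately have "\<Union>\<C> \<in> C"
        by (rule C_closed)
      moreover have "\<Union>\<C> = cl X"
      proof
        show "\<Union>\<C> \<subseteq> cl X"
          unfolding \<C>_def using finitary_hull.cl_mono[OF hull under_sub] by blast
        show "cl X \<subseteq> \<Union>\<C>"
        proof
          fix z
          assume "z \<in> cl X"
          then obtain s where s: "s \<subseteq> X" "finite s" "z \<in> cl s"
            using finitary_hull.cl_finitary[OF hull] by blast
          \<comment> \<open>An infinite cardinal order has no last element, so a finite set fits
            into one proper initial segment; with finite character the chain exhausts
            \<open>cl X\<close>.\<close>
          have "\<exists>x\<in>X. s \<subseteq> underS ?r x"
            using s(2,1)
          proof (induction s)
            case empty
            then show ?case
              using False by (metis empty_subsetI equals0I finite.emptyI)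
          next
            case (insert y s)
            then obtain x where x: "x \<in> X" "s \<subseteq> underS ?r x"
              by auto
            have wo: "wo_rel ?r"
              using card_of_Well_order unfolding wo_rel_def .
            then have trans: "trans ?r" and antisym: "antisym ?r"
              by (simp_all add: wo_rel.TRANS wo_rel.ANTISYM)
            obtain w where w: "w \<in> X" "(x, w) \<in> ?r" "(y, w) \<in> ?r"
              using wo_rel.TOTALS[OF wo] x(1) insert.prems unfolding Field by blast
            obtain v where v: "v \<in> X" "w \<noteq> v" "(w, v) \<in> ?r"
              using infinite_Card_order_limit[of ?r w] card_of_Card_order False w(1) Field by metis
            have "a \<in> underS ?r v" if "(a, w) \<in> ?r" for a
              using that v trans antisym unfolding underS_def trans_def antisym_def by blast
            moreover have "(a, w) \<in> ?r" if "a \<in> s" for a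
              using that x(2) w(2) trans unfolding underS_def trans_def by blast
            ultimately have "insert y s \<subseteq> underS ?r v"
              using w(3) by blast
            then show ?case
              using v(1) by blast
          qed
          then show "z \<in> \<Union>\<C>"
            using s(3) finitary_hull.cl_mono[OF hull] unfolding \<C>_def by blast
        qed
      qed
      ultimately show ?thesis
        by simp
    qed
  qed
  then show ?thesis
    using that hull by blast
qed


section \<open>Prescribing cofinalities\<close>

text \<open>There are only countably many finite sets of naturals. If each of them ceased to occur
  as a value from some bound on, these bounds would have a common bound below
  \<open>\<kappa>\<close>, beyond which \<open>e\<close> would have no value left.\<close>

lemma regular_uncountable_pigeonhole:
  fixes e :: "'a::wellorder \<Rightarrow> nat set"
  assumes \<kappa>: "regular_uncountable \<kappa>"
    and E: "\<And>\<xi>. \<xi> < \<kappa> \<Longrightarrow> \<exists>v\<in>E. \<xi> \<le> v \<and> v < \<kappa>"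
    and fin: "\<And>v. v \<in> E \<Longrightarrow> v < \<kappa> \<Longrightarrow> finite (e v)"
  shows "\<exists>d. finite d \<and> (\<forall>\<xi><\<kappa>. \<exists>v\<in>E. \<xi> \<le> v \<and> v < \<kappa> \<and> e v = d)"
proof (rule ccontr)
  assume contra: "\<not> ?thesis"
  have "\<exists>\<xi><\<kappa>. \<forall>v\<in>E. \<xi> \<le> v \<and> v < \<kappa> \<longrightarrow> e v \<noteq> d" if "finite d" for d
  proof -
    have "\<not> (\<forall>\<xi><\<kappa>. \<exists>v\<in>E. \<xi> \<le> v \<and> v < \<kappa> \<and> e v = d)"
      using contra that by simp
    then show ?thesis
      by (metis (no_types))
  qed
  then obtain b where b: "\<And>d. finite d \<Longrightarrow> b d < \<kappa> \<and> (\<forall>v\<in>E. b d \<le> v \<and> v < \<kappa> \<longrightarrow> e v \<noteq> d)"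
    by metis
  \<comment> \<open>\<open>set_decode\<close> enumerates the finite sets of naturals, which makes
    the bounds a countable sequence.\<close>
  have "b (set_decode i) < \<kappa>" for i
    using b finite_set_decode by blast
  then obtain \<beta> where \<beta>: "\<beta> < \<kappa>" "\<And>i. b (set_decode i) < \<beta>"
    using regular_uncountable_countable_bounded[OF \<kappa>, of "\<lambda>i. b (set_decode i)"] by metis
  obtain v where v: "v \<in> E" "\<beta> \<le> v" "v < \<kappa>"
    using E \<beta>(1) by blast
  have "b (e v) < \<beta>"
    using \<beta>(2)[of "set_encode (e v)"] fin[OF v(1,3)] by simp
  then show False
    using b[OF fin[OF v(1,3)]] v by force
qed

definition trace :: "nat set \<Rightarrow> ('b \<Rightarrow> nat \<Rightarrow> 'a) \<Rightarrow> 'b set \<Rightarrow> 'a set" where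
  "trace A F \<Gamma> = (\<Union>\<gamma>\<in>\<Gamma>. F \<gamma> ` A)"

lemma trace_mono: "\<Gamma> \<subseteq> \<Gamma>' \<Longrightarrow> trace A F \<Gamma> \<subseteq> trace A F \<Gamma>'"
  unfolding trace_def by blast

lemma trace_image: "trace A F (h ` E) = (\<Union>\<zeta>\<in>E. F (h \<zeta>) ` A)"
  unfolding trace_def by simp

lemma less_mod_finite_trans:
  fixes f g h :: "nat \<Rightarrow> 'a::linorder"
  assumes "less_mod A {X. finite X} f g" "less_mod A {X. finite X} g h"
  shows "less_mod A {X. finite X} f h"
proof -
  have "{k \<in> A. f k \<ge> h k} \<subseteq> {k \<in> A. f k \<ge> g k} \<union> {k \<in> A. g k \<ge> h k}"
    by auto
  then show ?thesis
    using assms finite_subset unfolding less_mod_def by blast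
qed

section \<open>Cofinality of a hull below a single aleph\<close>

context finitary_hull
begin

text \<open>
  The witnesses lie in the smaller set \<open>Y\<close> but dominate the larger hull of \<open>Z\<close>, so the cofinality
  at \<open>aleph k\<close> is frozen for every set of generators between \<open>Y\<close> and \<open>Z\<close>.
\<close>

definition cofinal_in :: "'a set \<Rightarrow> 'a set \<Rightarrow> nat \<Rightarrow> 'a \<Rightarrow> bool" where
  "cofinal_in Y Z k \<kappa> \<longleftrightarrow> (\<exists>\<eta>. (\<forall>\<xi><\<kappa>. \<eta> \<xi> \<in> Y \<inter> {..<aleph k}) \<and>
     (\<forall>\<xi>'<\<kappa>. \<forall>\<xi>\<le>\<xi>'. \<eta> \<xi> \<le> \<eta> \<xi>') \<and> (\<forall>z\<in>cl Z \<inter> {..<aleph k}. \<exists>\<xi><\<kappa>. z < \<eta> \<xi>))"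

lemma cofinal_in_mono:
  assumes "cofinal_in Y Z k \<kappa>" "Y \<subseteq> Y'" "Z' \<subseteq> Z"
  shows "cofinal_in Y' Z' k \<kappa>"
proof -
  obtain \<eta> where "\<forall>\<xi><\<kappa>. \<eta> \<xi> \<in> Y \<inter> {..<aleph k}" "\<forall>\<xi>'<\<kappa>. \<forall>\<xi>\<le>\<xi>'. \<eta> \<xi> \<le> \<eta> \<xi>'"
    "\<forall>z\<in>cl Z \<inter> {..<aleph k}. \<exists>\<xi><\<kappa>. z < \<eta> \<xi>"
    using assms(1) unfolding cofinal_in_def by blast
  moreover have "\<forall>\<xi><\<kappa>. \<eta> \<xi> \<in> Y' \<inter> {..<aleph k}" "\<forall>z\<in>cl Z' \<inter> {..<aleph k}. \<exists>\<xi><\<kappa>. z < \<eta> \<xi>"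
    using calculation(1,3) assms(2) cl_mono[OF assms(3)] by auto
  ultimately show ?thesis
    unfolding cofinal_in_def by (intro exI[of _ \<eta>] conjI)
qed

lemma cf_hull_eqI:
  assumes "regular_uncountable \<kappa>" "is_cardinal \<kappa>" "X \<subseteq> aleph_omega" "cofinal_in X X k \<kappa>"
  shows "cf (cl X \<inter> {..<aleph k}) = \<kappa>"
proof -
  obtain \<eta> where \<eta>: "\<forall>\<xi><\<kappa>. \<eta> \<xi> \<in> X \<inter> {..<aleph k}" "\<forall>\<xi>'<\<kappa>. \<forall>\<xi>\<le>\<xi>'. \<eta> \<xi> \<le> \<eta> \<xi>'"
    "\<forall>z\<in>cl X \<inter> {..<aleph k}. \<exists>\<xi><\<kappa>. z < \<eta> \<xi>"
    using assms(4) unfolding cofinal_in_def by blast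
  show ?thesis
    using \<eta> cl_extensive[OF assms(3)] by (intro cf_eqI[OF assms(1,2), of \<eta>]) auto
qed

lemma aleph_subset_omega: "{..<aleph k} \<subseteq> aleph_omega"
  unfolding aleph_omega_def by blast

lemma hull_bounded:
  assumes "X \<subseteq> aleph_omega" "m \<le> k" "|X| \<le>o |{..<aleph k :: 'a}|"
  obtains \<beta> where "\<beta> < aleph (Suc k)" "cl X \<inter> {..<aleph (Suc k)} \<subseteq> {..<\<beta>}"
proof (rule bounded_below_aleph_Suc[OF alephs])
  show "cl X \<inter> {..<aleph (Suc k)} \<subseteq> {..<aleph (Suc k)}"
    by blast
  have "|cl X \<inter> {..<aleph (Suc k)}| \<le>o |cl X|"
    by (intro card_of_mono1) blast
  then show "|cl X \<inter> {..<aleph (Suc k)}| \<le>o |{..<aleph k :: 'a}|"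
    using cl_card[OF assms] ordLeq_transitive by blast
qed

text \<open>By finite character an element of the hull uses finitely many of the
  \<open>B \<zeta>\<close>, and finitely many indices are bounded below \<open>\<kappa>\<close>.
  Cofinality in the full hull is thereby reduced to its stages.\<close>

lemma cl_initial_segment:
  assumes \<kappa>: "regular_uncountable \<kappa>" and E: "E \<subseteq> {..<\<kappa>}" and z: "z \<in> cl (Y \<union> (\<Union>\<zeta>\<in>E. B \<zeta>))"
  obtains \<xi> where "\<xi> < \<kappa>" "z \<in> cl (Y \<union> (\<Union>\<zeta>\<in>E \<inter> {..<\<xi>}. B \<zeta>))"
proof -
  obtain s where s: "s \<subseteq> Y \<union> (\<Union>\<zeta>\<in>E. B \<zeta>)" "finite s" "z \<in> cl s"
    using cl_finitary[OF z] by blast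
  then have "\<forall>x\<in>s - Y. \<exists>\<zeta>\<in>E. x \<in> B \<zeta>"
    by blast
  then obtain f where f: "\<And>x. x \<in> s - Y \<Longrightarrow> f x \<in> E \<and> x \<in> B (f x)"
    by metis
  have "f ` (s - Y) \<subseteq> {..<\<kappa>}" "finite (f ` (s - Y))"
    using f E s(2) by auto
  then obtain \<xi> where \<xi>: "\<xi> < \<kappa>" "f ` (s - Y) \<subseteq> {..<\<xi>}"
    using regular_uncountable_finite_bounded[OF \<kappa>] by blast
  have "s \<subseteq> Y \<union> (\<Union>\<zeta>\<in>E \<inter> {..<\<xi>}. B \<zeta>)"
  proof
    fix x assume "x \<in> s"
    then show "x \<in> Y \<union> (\<Union>\<zeta>\<in>E \<inter> {..<\<xi>}. B \<zeta>)"
      using f[of x] \<xi>(2) by blast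
  qed
  then show ?thesis
    using that \<xi>(1) cl_mono s(3) by blast
qed

text \<open>A recursion of length \<open>\<kappa>\<close>: each term bounds, below
  \<open>aleph (Suc j)\<close>, the hull of \<open>Y\<close>, all of \<open>aleph j\<close> and the
  earlier terms. Such a bound exists because these are at most \<open>aleph j\<close> many
  generators. This serves the exceptional coordinates, one at a time.\<close>

lemma prescribe_cofinality_at_aleph:
  assumes \<kappa>: "regular_uncountable \<kappa>" "|{..<\<kappa>}| \<le>o |{..<aleph m :: 'a}|"
    and Y: "Y \<subseteq> aleph_omega" "|Y| \<le>o |{..<aleph m :: 'a}|" and j: "m \<le> j"
  obtains \<Gamma> where "\<Gamma> \<subseteq> {..<aleph (Suc j)}" "|\<Gamma>| \<le>o |{..<aleph m :: 'a}|"
    "cofinal_in \<Gamma> (Y \<union> \<Gamma> \<union> {..<aleph j}) (Suc j) \<kappa>"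
proof -
  define X where "X = (\<lambda>\<xi> h. Y \<union> {..<aleph j} \<union> (\<Union>\<zeta>\<in>{..<\<xi>::'a}. {h \<zeta>}))"
  define bound where "bound = (\<lambda>Z \<beta>. \<beta> < aleph (Suc j) \<and> cl Z \<inter> {..<aleph (Suc j)} \<subseteq> {..<\<beta>})"
  have "X \<xi> f = X \<xi> g" if "\<And>\<zeta>. \<zeta> < \<xi> \<Longrightarrow> f \<zeta> = g \<zeta>" for \<xi> f g
    using that unfolding X_def by auto
  then have "(SOME \<beta>. bound (X \<xi> f) \<beta>) = (SOME \<beta>. bound (X \<xi> g) \<beta>)"
    if "\<And>\<zeta>. \<zeta> < \<xi> \<Longrightarrow> f \<zeta> = g \<zeta>" for \<xi> f g
    using that by metis
  then obtain h where h: "\<And>\<xi>. h \<xi> = (SOME \<beta>. bound (X \<xi> h) \<beta>)"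
    using wellorder_recursion[of "\<lambda>\<xi> h. SOME \<beta>. bound (X \<xi> h) \<beta>"] by blast
  have bound: "bound (X \<xi> h) (h \<xi>)" if "\<xi> < \<kappa>" for \<xi>
    using that
  proof (induction \<xi> rule: less_induct)
    case (less \<xi>)
    have h_less: "h \<zeta> < aleph (Suc j)" if "\<zeta> < \<xi>" for \<zeta>
      using less that unfolding bound_def by force
    have "(\<Union>\<zeta>\<in>{..<\<xi>}. {h \<zeta>}) \<subseteq> aleph_omega"
      using h_less aleph_subset_omega[of "Suc j"] by auto
    then have sub: "X \<xi> h \<subseteq> aleph_omega"
      unfolding X_def using Y(1) aleph_subset_omega[of j] by blast
    have "{..<\<xi>} \<subseteq> {..<\<kappa>}"
      using less.prems by auto
    then have "|{..<\<xi>}| \<le>o |{..<aleph m :: 'a}|"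
      using \<kappa>(2) card_of_mono1 ordLeq_transitive by blast
    then have "|\<Union>\<zeta>\<in>{..<\<xi>}. {h \<zeta>}| \<le>o |{..<aleph m :: 'a}|"
      by (intro UN_ordLeq_aleph[OF alephs]) (auto intro: finite_ordLeq_aleph[OF alephs])
    then have "|X \<xi> h| \<le>o |{..<aleph j :: 'a}|"
      unfolding X_def using ordLeq_aleph_trans[OF alephs _ j] Y(2)
      by (intro Un_ordLeq_aleph[OF alephs]) (auto intro: card_of_mono1)
    then obtain \<beta> where "bound (X \<xi> h) \<beta>"
      using hull_bounded[OF sub j] unfolding bound_def by blast
    then show ?case
      using h[of \<xi>] someI[of "bound (X \<xi> h)"] by metis
  qed
  let ?\<Gamma> = "h ` {..<\<kappa>}"
  have sub: "?\<Gamma> \<subseteq> {..<aleph (Suc j)}"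
    using bound unfolding bound_def by auto
  \<comment> \<open>An earlier term is a generator at stage \<open>\<xi>\<close>, hence lies in the
    hull that \<open>h \<xi>\<close> bounds.\<close>
  have mono: "h \<zeta> \<le> h \<xi>" if "\<zeta> \<le> \<xi>" "\<xi> < \<kappa>" for \<zeta> \<xi>
  proof (cases "\<zeta> = \<xi>")
    case False
    then have less: "\<zeta> < \<xi>"
      using that(1) by simp
    have "h \<zeta> < aleph (Suc j)"
      using sub less that(2) by (metis image_subset_iff lessThan_iff order_less_trans)
    moreover from this have "{h \<zeta>} \<subseteq> cl {h \<zeta>}"
      using aleph_subset_omega[of "Suc j"] by (intro cl_extensive) auto
    moreover have "cl {h \<zeta>} \<subseteq> cl (X \<xi> h)"
      using less unfolding X_def by (intro cl_mono) blast
    ultimately show ?thesis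
      using bound[OF that(2)] unfolding bound_def by fastforce
  qed simp
  have cofinal: "\<exists>\<xi><\<kappa>. z < h \<xi>" if "z \<in> cl (Y \<union> ?\<Gamma> \<union> {..<aleph j})" "z < aleph (Suc j)" for z
  proof -
    have "Y \<union> ?\<Gamma> \<union> {..<aleph j} = Y \<union> {..<aleph j} \<union> (\<Union>\<zeta>\<in>{..<\<kappa>}. {h \<zeta>})"
      by blast
    then obtain \<xi> where \<xi>: "\<xi> < \<kappa>" "z \<in> cl (Y \<union> {..<aleph j} \<union> (\<Union>\<zeta>\<in>{..<\<kappa>} \<inter> {..<\<xi>}. {h \<zeta>}))"
      using cl_initial_segment[OF \<kappa>(1) subset_refl] \<open>z \<in> cl _\<close> by metis
    moreover have "{..<\<kappa>} \<inter> {..<\<xi>} = {..<\<xi>}"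
      using \<xi>(1) by auto
    ultimately have "z \<in> cl (X \<xi> h)"
      unfolding X_def by simp
    then show ?thesis
      using bound[OF \<xi>(1)] \<open>z < _\<close> \<xi>(1) unfolding bound_def by blast
  qed
  have "cofinal_in ?\<Gamma> (Y \<union> ?\<Gamma> \<union> {..<aleph j}) (Suc j) \<kappa>"
    unfolding cofinal_in_def
  proof (intro exI[of _ h] conjI allI ballI impI)
    show "h \<xi> \<in> ?\<Gamma> \<inter> {..<aleph (Suc j)}" if "\<xi> < \<kappa>" for \<xi>
      using that sub by auto
    show "\<exists>\<xi><\<kappa>. z < h \<xi>" if "z \<in> cl (Y \<union> ?\<Gamma> \<union> {..<aleph j}) \<inter> {..<aleph (Suc j)}" for z
      using cofinal that by auto
  qed (rule mono)
  then show ?thesis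
    using that sub image_ordLeq[OF alephs \<kappa>(2)] by blast
qed

end


section \<open>One level: prescribing a cofinality at almost all coordinates of a scale\<close>

context finitary_hull
begin

lemma trace_card:
  assumes "|\<Gamma>| \<le>o |{..<aleph m :: 'a}|"
  shows "|trace A F \<Gamma> :: 'a set| \<le>o |{..<aleph m :: 'a}|"
  unfolding trace_def
  using assms image_ordLeq[OF alephs countable_ordLeq_aleph[OF alephs]] by (intro UN_ordLeq_aleph[OF alephs])

lemma trace_subset_omega:
  assumes "\<And>\<alpha>. \<alpha> \<in> \<Gamma> \<Longrightarrow> F \<alpha> \<in> (\<Pi>\<^sub>E k\<in>A. {..<aleph k})"
  shows "trace A F \<Gamma> \<subseteq> aleph_omega"
proof
  fix x
  assume "x \<in> trace A F \<Gamma>"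
  then obtain \<gamma> k where "\<gamma> \<in> \<Gamma>" "k \<in> A" "x = F \<gamma> k"
    unfolding trace_def by blast
  then show "x \<in> aleph_omega"
    using assms[of \<gamma>] unfolding aleph_omega_def by auto
qed

text \<open>\<open>\<D>\<close> lists the possible contributions of levels treated later. One
  \<open>\<Gamma>\<close> works for every \<open>D\<close>; only the finite set of exceptions
  depends on \<open>D\<close>. That \<open>\<Gamma>\<close> lies in a member of \<open>\<P>\<close>
  lets the levels treated earlier anticipate it.\<close>

lemma prescribe_cofinality_mod_finite:
  fixes F :: "'b \<Rightarrow> nat \<Rightarrow> 'a" and \<mu> :: "'b rel"
  assumes \<mu>: "Cinfinite \<mu>" "regularCard \<mu>"
    and F: "\<And>\<alpha>. \<alpha> \<in> Field \<mu> \<Longrightarrow> F \<alpha> \<in> (\<Pi>\<^sub>E k\<in>A. {..<aleph k})"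
    and F_less: "\<And>\<alpha> \<beta>. (\<alpha>, \<beta>) \<in> \<mu> \<Longrightarrow> \<alpha> \<noteq> \<beta> \<Longrightarrow> less_mod A {X. finite X} (F \<alpha>) (F \<beta>)"
    and F_cofinal: "\<And>g. g \<in> (\<Pi>\<^sub>E k\<in>A. {..<aleph k}) \<Longrightarrow> \<exists>\<alpha>\<in>Field \<mu>. less_mod A {X. finite X} g (F \<alpha>)"
    and A: "A \<subseteq> {Suc m..}"
    and \<kappa>: "regular_uncountable \<kappa>" "|{..<\<kappa>}| \<le>o |{..<aleph m :: 'a}|"
    and \<P>: "regular_cardinal.guessing \<mu> \<kappa> \<P>"
    and Y: "Y \<subseteq> aleph_omega" "|Y| \<le>o |{..<aleph m :: 'a}|"
    and \<D>: "|\<D>| <o \<mu>" "\<And>D. D \<in> \<D> \<Longrightarrow> D \<subseteq> aleph_omega \<and> |D| \<le>o |{..<aleph m :: 'a}|"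
  obtains C \<Gamma> where "C \<in> \<P>" "\<Gamma> \<subseteq> C" "\<Gamma> \<subseteq> Field \<mu>" "|\<Gamma>| \<le>o |{..<aleph m :: 'a}|"
    "\<And>D. D \<in> \<D> \<Longrightarrow> \<exists>e. finite e \<and>
       (\<forall>k\<in>A - e. cofinal_in (trace A F \<Gamma>) (Y \<union> trace A F \<Gamma> \<union> D \<union> {..<aleph (k - 1)}) k \<kappa>)"
proof -
  interpret regular_cardinal \<mu>
    using \<mu> by unfold_locales
  let ?m = "|{..<aleph m :: 'a}|"
  let ?I = "{X :: nat set. finite X}"
  define X where "X = (\<lambda>D S k. Y \<union> trace A F S \<union> D \<union> {..<aleph (k - 1)})"
  define bound where
    "bound = (\<lambda>D S k \<beta>. \<beta> < aleph k \<and> cl (X D S k) \<inter> {..<aleph k} \<subseteq> {..<\<beta>})"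
  \<comment> \<open>Bounds for the hulls at all coordinates at once; restricting to \<open>A\<close>
    gives a member of the product, which the scale can dominate.\<close>
  define H where "H = (\<lambda>D S. restrict (\<lambda>k. SOME \<beta>. bound D S k \<beta>) A)"
  have X_omega: "X D S k \<subseteq> aleph_omega" if "D \<in> \<D>" "S \<subseteq> Field \<mu>" for D S k
  proof -
    have "trace A F S \<subseteq> aleph_omega"
      using F that(2) by (intro trace_subset_omega) blast
    then show ?thesis
      unfolding X_def using Y(1) \<D>(2)[OF that(1)] aleph_subset_omega[of "k - 1"] by blast
  qed
  have H_bound: "bound D S k (H D S k)"
    if D: "D \<in> \<D>" and S: "S \<subseteq> Field \<mu>" "|S| \<le>o ?m" and k: "k \<in> A" for D S k
  proof -
    obtain j where j: "k = Suc j" "m \<le> j"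
      using A k by (cases k) auto
    have "|X D S k| \<le>o |{..<aleph j :: 'a}|"
      unfolding X_def using ordLeq_aleph_trans[OF alephs _ j(2)] Y(2) \<D>(2)[OF D] trace_card[OF S(2)] j(1)
      by (intro Un_ordLeq_aleph[OF alephs]) (auto intro: card_of_mono1)
    then obtain \<beta> where "bound D S k \<beta>"
      using hull_bounded[OF X_omega[OF D S(1)] j(2)] j(1) unfolding bound_def by blast
    then have "bound D S k (SOME \<beta>. bound D S k \<beta>)"
      by (rule someI)
    then show ?thesis
      unfolding H_def using k by simp
  qed
  have H_prod: "H D S \<in> (\<Pi>\<^sub>E k\<in>A. {..<aleph k})" if "D \<in> \<D>" "S \<subseteq> Field \<mu>" "|S| \<le>o ?m" for D S
  proof
    show "H D S k \<in> {..<aleph k}" if "k \<in> A" for k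
      using H_bound[OF \<open>D \<in> \<D>\<close> \<open>S \<subseteq> _\<close> \<open>|S| \<le>o _\<close> that] unfolding bound_def by simp
    show "H D S k = undefined" if "k \<notin> A" for k
      using that unfolding H_def by simp
  qed
  \<comment> \<open>Each \<open>D\<close> yields its own index in the scale; being fewer than
    \<open>\<mu>\<close>, these indices have a common strict bound.\<close>
  have "\<exists>\<alpha>\<in>Field \<mu>. \<forall>D\<in>\<D>. less_mod A ?I (H D S) (F \<alpha>)" if S: "S \<subseteq> Field \<mu>" "|S| \<le>o ?m" for S
  proof -
    have "\<forall>D\<in>\<D>. \<exists>\<alpha>\<in>Field \<mu>. less_mod A ?I (H D S) (F \<alpha>)"
      using F_cofinal H_prod S by blast
    then obtain a where a: "\<And>D. D \<in> \<D> \<Longrightarrow> a D \<in> Field \<mu> \<and> less_mod A ?I (H D S) (F (a D))"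
      by metis
    have "a ` \<D> \<subseteq> Field \<mu>" "|a ` \<D>| <o \<mu>"
      using a \<D>(1) card_of_image ordLeq_ordLess_trans by blast+
    then obtain \<alpha> where \<alpha>: "\<alpha> \<in> Field \<mu>" "\<And>b. b \<in> a ` \<D> \<Longrightarrow> b \<prec> \<alpha>"
      using strictly_bounded by blast
    have "less_mod A ?I (H D S) (F \<alpha>)" if "D \<in> \<D>" for D
      using a[OF that] \<alpha>(2)[of "a D"] F_less[of "a D" \<alpha>] that less_mod_finite_trans
      unfolding less_def by blast
    then show ?thesis
      using \<alpha>(1) by blast
  qed
  \<comment> \<open>A default value, so that \<open>g\<close> is total, also at sets that are too
    large or leave the field.\<close>
  moreover obtain \<alpha>0 where "\<alpha>0 \<in> Field \<mu>"
    using F_cofinal[of "restrict (\<lambda>k. aleph 0) A"] strictly_bounded[of "{}"] card_of_empty1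
      Cinfinite by (metis Card_order_iff_ordLeq_card_of Cinfinite_Cnotzero Cnotzero_imp_not_empty all_not_in_conv)
  ultimately have "\<forall>S. \<exists>\<alpha>. \<alpha> \<in> Field \<mu> \<and>
      (S \<subseteq> Field \<mu> \<longrightarrow> |S| \<le>o ?m \<longrightarrow> (\<forall>D\<in>\<D>. less_mod A ?I (H D S) (F \<alpha>)))"
    by blast
  then obtain g where g_Field: "\<And>S. g S \<in> Field \<mu>"
    and g: "\<And>S D. S \<subseteq> Field \<mu> \<Longrightarrow> |S| \<le>o ?m \<Longrightarrow> D \<in> \<D> \<Longrightarrow> less_mod A ?I (H D S) (F (g S))"
    by metis
  have "range g \<subseteq> Field \<mu>"
    using g_Field by blast
  from \<P>[unfolded guessing_def, THEN spec, THEN mp, OF this] obtain C h where C: "C \<in> \<P>" and h_Field: "\<forall>\<xi><\<kappa>. h \<xi> \<in> Field \<mu>"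
    and h_C: "\<forall>\<xi><\<kappa>. \<exists>\<xi>'<\<kappa>. \<xi> \<le> \<xi>' \<and> h \<xi>' \<in> C"
    and h: "\<forall>\<xi><\<kappa>. \<forall>\<zeta><\<xi>. g (h ` {..\<zeta>}) \<prec> h \<xi>"
    by (elim bexE exE conjE) (rule that)
  \<comment> \<open>Only the terms of \<open>h\<close> in \<open>C\<close> are kept. The next kept
    term after \<open>v\<close> still exceeds the demand made by all terms up to \<open>v\<close>,
    kept or not.\<close>
  define E where "E = {\<xi>. \<xi> < \<kappa> \<and> h \<xi> \<in> C}"
  have E_less: "\<xi> < \<kappa>" if "\<xi> \<in> E" for \<xi>
    using that unfolding E_def by blast
  define nxt where "nxt = (\<lambda>\<xi>. LEAST v. v \<in> E \<and> \<xi> < v)"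
  have nxt: "nxt \<xi> \<in> E" "\<xi> < nxt \<xi>" if "\<xi> < \<kappa>" for \<xi>
  proof -
    obtain \<xi>' where "\<xi> < \<xi>'" "\<xi>' < \<kappa>"
      using regular_uncountable_limit[OF \<kappa>(1) \<open>\<xi> < \<kappa>\<close>] .
    then obtain v where "v \<in> E" "\<xi> < v"
      using h_C unfolding E_def by (metis (mono_tags) mem_Collect_eq order_less_le_trans)
    then have "nxt \<xi> \<in> E \<and> \<xi> < nxt \<xi>"
      using LeastI[of "\<lambda>v. v \<in> E \<and> \<xi> < v" v] unfolding nxt_def by blast
    then show "nxt \<xi> \<in> E" "\<xi> < nxt \<xi>"
      by blast+
  qed
  have nxt_le: "nxt \<xi> \<le> v" if "v \<in> E" "\<xi> < v" for \<xi> v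
    using that unfolding nxt_def by (auto intro: Least_le)
  define \<Gamma> where "\<Gamma> = h ` E"
  have seg: "h ` {..\<xi>} \<subseteq> Field \<mu>" "|h ` {..\<xi>}| \<le>o ?m" if "\<xi> < \<kappa>" for \<xi>
  proof -
    have "{..\<xi>} \<subseteq> {..<\<kappa>}"
      using that by auto
    then have "|{..\<xi>}| \<le>o ?m"
      using \<kappa>(2) card_of_mono1 ordLeq_transitive by blast
    then show "|h ` {..\<xi>}| \<le>o ?m"
      by (rule image_ordLeq[OF alephs])
    show "h ` {..\<xi>} \<subseteq> Field \<mu>"
      using that h_Field by auto
  qed
  have \<Gamma>: "\<Gamma> \<subseteq> C" "\<Gamma> \<subseteq> Field \<mu>"
    unfolding \<Gamma>_def E_def using h_Field by auto
  have "E \<subseteq> {..<\<kappa>}"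
    unfolding E_def by blast
  then have "|E| \<le>o ?m"
    using \<kappa>(2) card_of_mono1 ordLeq_transitive by blast
  then have \<Gamma>_card: "|\<Gamma>| \<le>o ?m"
    unfolding \<Gamma>_def by (rule image_ordLeq[OF alephs])
  have "\<exists>e. finite e \<and> (\<forall>k\<in>A - e. cofinal_in (trace A F \<Gamma>) (X D \<Gamma> k) k \<kappa>)" if D: "D \<in> \<D>" for D
  proof -
    \<comment> \<open>The coordinates at which the next kept scale function fails to bound the hull
      of stage \<open>v\<close>. The growth of \<open>h\<close> makes them finitely many, and the
      pigeonhole principle makes them the same set \<open>e\<close> for cofinally many
      \<open>v\<close>.\<close>
    define ex where "ex = (\<lambda>v. {k \<in> A. H D (h ` {..v}) k \<ge> F (h (nxt v)) k})"
    have "finite (ex v)" if v: "v < \<kappa>" for v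
    proof -
      have "g (h ` {..v}) \<prec> h (nxt v)"
        using h nxt[OF v] E_less by blast
      then have "less_mod A ?I (F (g (h ` {..v}))) (F (h (nxt v)))"
        using F_less unfolding less_def by blast
      then have "less_mod A ?I (H D (h ` {..v})) (F (h (nxt v)))"
        using g[OF seg[OF v] D] less_mod_finite_trans by blast
      then show ?thesis
        unfolding less_mod_def ex_def by simp
    qed
    moreover have "\<exists>v\<in>E. \<xi> \<le> v \<and> v < \<kappa>" if "\<xi> < \<kappa>" for \<xi>
      using that h_C unfolding E_def by blast
    ultimately obtain e where e: "finite e" "\<forall>\<xi><\<kappa>. \<exists>v\<in>E. \<xi> \<le> v \<and> v < \<kappa> \<and> ex v = e"
      using regular_uncountable_pigeonhole[OF \<kappa>(1), of E ex] by blast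
    define V where "V = {v \<in> E. ex v = e}"
    \<comment> \<open>Re-indexes \<open>V\<close> by all of \<open>\<kappa>\<close>, with
      repetitions; \<open>cofinal_in\<close> asks only for weak monotonicity.\<close>
    define w where "w = (\<lambda>\<xi>. LEAST v. v \<in> V \<and> \<xi> \<le> v)"
    have w: "w \<xi> \<in> V" "\<xi> \<le> w \<xi>" if "\<xi> < \<kappa>" for \<xi>
    proof -
      obtain v where "v \<in> V \<and> \<xi> \<le> v"
        using e(2) \<open>\<xi> < \<kappa>\<close> unfolding V_def by blast
      then have "w \<xi> \<in> V \<and> \<xi> \<le> w \<xi>"
        unfolding w_def by (rule LeastI)
      then show "w \<xi> \<in> V" "\<xi> \<le> w \<xi>"
        by blast+
    qed
    have w_le: "w \<xi> \<le> v" if "v \<in> V" "\<xi> \<le> v" for \<xi> v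
      using that unfolding w_def by (auto intro: Least_le)
    have V_less: "v < \<kappa>" if "v \<in> V" for v
      using that E_less unfolding V_def by blast
    have "cofinal_in (trace A F \<Gamma>) (X D \<Gamma> k) k \<kappa>" if k: "k \<in> A - e" for k
    proof -
      have step: "z < F (h (nxt v)) k" if "v \<in> V" "z \<in> cl (X D (h ` {..v}) k)" "z < aleph k" for v z
      proof -
        have "z < H D (h ` {..v}) k"
          using H_bound[OF D seg[OF V_less[OF \<open>v \<in> V\<close>]]] k that(2,3) unfolding bound_def by blast
        moreover have "k \<notin> ex v"
          using \<open>v \<in> V\<close> k unfolding V_def by blast
        ultimately show ?thesis
          using k unfolding ex_def by force
      qed
      have F_less_aleph: "F (h v) k < aleph k" if "v < \<kappa>" for v
        using F[of "h v"] h_Field that k by auto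
      have nxt_V: "nxt v \<in> E" "v < nxt v" "nxt v < \<kappa>" if "v \<in> V" for v
        using nxt[OF V_less[OF that]] E_less by blast+
      \<comment> \<open>Since \<open>nxt v \<le> v'\<close>, the value belonging to \<open>v\<close>
        is among the generators of stage \<open>v'\<close>, whose hull the value belonging to
        \<open>v'\<close> bounds.\<close>
      have increasing: "F (h (nxt v)) k < F (h (nxt v')) k" if v: "v \<in> V" "v' \<in> V" "v < v'" for v v'
      proof (rule step[OF v(2) _ F_less_aleph[OF nxt_V(3)[OF v(1)]]])
        have "nxt v \<le> v'"
          using v nxt_le unfolding V_def by blast
        then have "F (h (nxt v)) k \<in> X D (h ` {..v'}) k"
          using k unfolding X_def trace_def by blast
        then show "F (h (nxt v)) k \<in> cl (X D (h ` {..v'}) k)"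
          using cl_extensive[OF X_omega[OF D seg(1)[OF V_less[OF v(2)]]]] by blast
      qed
      show ?thesis
        unfolding cofinal_in_def
      proof (intro exI[of _ "\<lambda>\<xi>. F (h (nxt (w \<xi>))) k"] conjI allI ballI impI)
        show "F (h (nxt (w \<xi>))) k \<in> trace A F \<Gamma> \<inter> {..<aleph k}" if "\<xi> < \<kappa>" for \<xi>
          using nxt_V[OF w(1)[OF that]] F_less_aleph k unfolding trace_def \<Gamma>_def by auto
      next
        fix \<xi>' \<xi>
        assume \<xi>: "\<xi>' < \<kappa>" "\<xi> \<le> \<xi>'"
        have "w \<xi> \<le> w \<xi>'"
          using w[OF \<xi>(1)] \<xi>(2) by (intro w_le) auto
        moreover have "\<xi> < \<kappa>"
          using \<xi> by simp
        ultimately show "F (h (nxt (w \<xi>))) k \<le> F (h (nxt (w \<xi>'))) k"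
          using increasing w(1) \<xi>(1) by (metis order_le_less)
      next
        fix z
        assume z: "z \<in> cl (X D \<Gamma> k) \<inter> {..<aleph k}"
        have "X D \<Gamma> k = Y \<union> D \<union> {..<aleph (k - 1)} \<union> (\<Union>\<zeta>\<in>E. F (h \<zeta>) ` A)"
          unfolding X_def \<Gamma>_def trace_image by blast
        then obtain \<xi> where \<xi>: "\<xi> < \<kappa>"
          "z \<in> cl (Y \<union> D \<union> {..<aleph (k - 1)} \<union> (\<Union>\<zeta>\<in>E \<inter> {..<\<xi>}. F (h \<zeta>) ` A))"
          using cl_initial_segment[OF \<kappa>(1) \<open>E \<subseteq> {..<\<kappa>}\<close>] z by (metis IntD1)
        have "(\<Union>\<zeta>\<in>E \<inter> {..<\<xi>}. F (h \<zeta>) ` A) \<subseteq> trace A F (h ` {..w \<xi>})"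
          unfolding trace_image using w(2)[OF \<xi>(1)] by (intro UN_mono) auto
        then have "cl (Y \<union> D \<union> {..<aleph (k - 1)} \<union> (\<Union>\<zeta>\<in>E \<inter> {..<\<xi>}. F (h \<zeta>) ` A)) \<subseteq> cl (X D (h ` {..w \<xi>}) k)"
          unfolding X_def by (intro cl_mono) blast
        then have "z < F (h (nxt (w \<xi>))) k"
          using step[OF w(1)[OF \<xi>(1)]] \<xi>(2) z by blast
        then show "\<exists>\<xi><\<kappa>. z < F (h (nxt (w \<xi>))) k"
          using \<xi>(1) by blast
      qed
    qed
    then show ?thesis
      using e(1) by blast
  qed
  then show ?thesis
    unfolding X_def using that[OF C \<Gamma> \<Gamma>_card] by blast
qed

end


section \<open>Iterated cardinal successors, up to isomorphism of cardinal orders\<close>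

lemma nth_cardSuc_unique:
  fixes \<mu> \<mu>' :: "'c rel"
  assumes "nth_cardSuc i r \<mu>" "nth_cardSuc i r \<mu>'"
  shows "\<mu> =o \<mu>'"
  using assms
proof (induction i arbitrary: \<mu> \<mu>')
  case 0
  then show ?case
    using ordIso_symmetric ordIso_transitive by fastforce
next
  case (Suc i)
  obtain \<nu> \<nu>' :: "'c rel" where \<nu>: "nth_cardSuc i r \<nu>" "\<mu> =o cardSuc \<nu>"
    and \<nu>': "nth_cardSuc i r \<nu>'" "\<mu>' =o cardSuc \<nu>'"
    using Suc.prems by auto
  have "Card_order \<nu>" "Card_order \<nu>'"
    using \<nu>(1) \<nu>'(1) by (cases i; simp)+
  then have "cardSuc \<nu> =o cardSuc \<nu>'"
    using Suc.IH[OF \<nu>(1) \<nu>'(1)] cardSuc_invar_ordIso by blast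
  then show ?case
    by (rule ordIso_transitive[OF \<nu>(2) ordIso_transitive[OF _ ordIso_symmetric[OF \<nu>'(2)]]])
qed

lemma nth_cardSuc_SucE:
  fixes \<mu> :: "'c rel"
  assumes "nth_cardSuc (Suc i) r \<mu>"
  obtains \<nu> :: "'c rel" where "nth_cardSuc i r \<nu>" "\<nu> <o \<mu>"
proof -
  obtain \<nu> :: "'c rel" where \<nu>: "nth_cardSuc i r \<nu>" "\<mu> =o cardSuc \<nu>"
    using assms by auto
  have "Card_order \<nu>"
    using \<nu>(1) by (cases i; simp)
  then have "\<nu> <o \<mu>"
    using cardSuc_greater \<nu>(2) ordIso_symmetric ordLess_ordIso_trans by blast
  then show ?thesis
    using that \<nu>(1) by blast
qed

text \<open>The chain of predecessors witnessing \<open>\<mu>'\<close> is unrelated to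
  \<open>\<mu>\<close>; uniqueness identifies its member at level \<open>i\<close> with
  \<open>\<mu>\<close>.\<close>

lemma nth_cardSuc_less:
  fixes \<mu> \<mu>' :: "'c rel"
  assumes "nth_cardSuc i r \<mu>" "nth_cardSuc j r \<mu>'" "i < j"
  shows "\<mu> <o \<mu>'"
  using assms(2,3)
proof (induction j arbitrary: \<mu>')
  case (Suc j)
  obtain \<nu> :: "'c rel" where \<nu>: "nth_cardSuc j r \<nu>" "\<nu> <o \<mu>'"
    using Suc.prems(1) by (rule nth_cardSuc_SucE)
  show ?case
  proof (cases "i = j")
    case True
    then show ?thesis
      using nth_cardSuc_unique[OF assms(1)] \<nu> ordIso_ordLess_trans by blast
  next
    case False
    then show ?thesis
      using Suc.IH[OF \<nu>(1)] Suc.prems(2) \<nu>(2) ordLess_transitive by force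
  qed
qed simp

lemma nth_cardSuc_greater:
  fixes \<mu> :: "'c rel"
  assumes "nth_cardSuc (Suc i) r \<mu>"
  shows "r <o \<mu>"
  using assms
proof (induction i arbitrary: \<mu>)
  case 0
  then obtain \<nu> :: "'c rel" where "nth_cardSuc 0 r \<nu>" "\<nu> <o \<mu>"
    by (rule nth_cardSuc_SucE)
  then show ?case
    using ordIso_symmetric ordIso_ordLess_trans by fastforce
next
  case (Suc i)
  obtain \<nu> :: "'c rel" where "nth_cardSuc (Suc i) r \<nu>" "\<nu> <o \<mu>"
    using Suc.prems by (rule nth_cardSuc_SucE)
  then show ?case
    using Suc.IH ordLess_transitive by blast
qed

section \<open>All levels together, then the finitely many exceptional coordinates\<close>

context finitary_hull
begin

text \<open>Levels are counted from 0 here, so \<open>i\<close> stands for the level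
  \<open>Suc i\<close> of the theorem. The induction descends from \<open>n\<close>, securing each
  level against everything the lower levels may still add.\<close>

lemma prescribe_cofinalities_mod_finite:
  fixes \<mu> :: "nat \<Rightarrow> 'b rel"
  assumes A: "\<And>i. i < n \<Longrightarrow> A i \<subseteq> {Suc m..}"
    and tcf: "\<And>i. i < n \<Longrightarrow> has_tcf (A i) (aleph :: nat \<Rightarrow> 'a) {X. finite X} (\<mu> i)"
    and \<mu>: "\<And>i. Suc i < n \<Longrightarrow> \<mu> i <o \<mu> (Suc i)" "\<And>i. i < n \<Longrightarrow> |{..<aleph m :: 'a}| <o \<mu> i"
    and \<kappa>: "\<And>i. i < n \<Longrightarrow> regular_uncountable (\<kappa> i)"
      "\<And>i. i < n \<Longrightarrow> |{..<\<kappa> i}| \<le>o |{..<aleph m :: 'a}|"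
  shows "\<exists>Y\<subseteq>aleph_omega. |Y| \<le>o |{..<aleph m :: 'a}| \<and>
    (\<forall>i<n. \<exists>e. finite e \<and> (\<forall>k\<in>A i - e. cofinal_in Y (Y \<union> {..<aleph (k - 1)}) k (\<kappa> i)))"
proof -
  let ?m = "|{..<aleph m :: 'a}|"
  let ?I = "{X :: nat set. finite X}"
  have "\<exists>\<P>. |\<P>| \<le>o \<mu> i \<and> (\<forall>C\<in>\<P>. C \<subseteq> Field (\<mu> i) \<and> |C| \<le>o ?m) \<and>
      regular_cardinal.guessing (\<mu> i) (\<kappa> i) \<P>" if i: "i < n" for i
  proof -
    interpret regular_cardinal "\<mu> i"
      using tcf[OF i] unfolding has_tcf_def by unfold_locales auto
    have "|{..<\<kappa> i}| <o \<mu> i"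
      using \<kappa>(2)[OF i] \<mu>(2)[OF i] ordLeq_ordLess_trans by blast
    then obtain \<P> where "|\<P>| \<le>o \<mu> i" "\<And>C. C \<in> \<P> \<Longrightarrow> C \<subseteq> Field (\<mu> i) \<and> |C| \<le>o |{..<\<kappa> i}|"
      "guessing (\<kappa> i) \<P>"
      using guessing_family[OF \<kappa>(1)[OF i]] by blast
    then show ?thesis
      using \<kappa>(2)[OF i] ordLeq_transitive by blast
  qed
  then obtain \<P> where \<P>: "\<And>i. i < n \<Longrightarrow> |\<P> i| \<le>o \<mu> i"
    "\<And>i C. i < n \<Longrightarrow> C \<in> \<P> i \<Longrightarrow> C \<subseteq> Field (\<mu> i) \<and> |C| \<le>o ?m"
    "\<And>i. i < n \<Longrightarrow> regular_cardinal.guessing (\<mu> i) (\<kappa> i) (\<P> i)"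
    by metis
  have "\<exists>F. (\<forall>\<alpha>\<in>Field (\<mu> i). F \<alpha> \<in> (\<Pi>\<^sub>E k\<in>A i. {..<aleph k :: 'a})) \<and>
      (\<forall>\<alpha> \<beta>. (\<alpha>, \<beta>) \<in> \<mu> i \<and> \<alpha> \<noteq> \<beta> \<longrightarrow> less_mod (A i) ?I (F \<alpha>) (F \<beta>)) \<and>
      (\<forall>g\<in>(\<Pi>\<^sub>E k\<in>A i. {..<aleph k}). \<exists>\<alpha>\<in>Field (\<mu> i). less_mod (A i) ?I g (F \<alpha>))" if "i < n" for i
    using tcf[OF that] unfolding has_tcf_def by blast
  then obtain F where
    F: "\<And>i. i < n \<Longrightarrow> \<forall>\<alpha>\<in>Field (\<mu> i). F i \<alpha> \<in> (\<Pi>\<^sub>E k\<in>A i. {..<aleph k :: 'a})"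
    and F_less: "\<And>i. i < n \<Longrightarrow>
      \<forall>\<alpha> \<beta>. (\<alpha>, \<beta>) \<in> \<mu> i \<and> \<alpha> \<noteq> \<beta> \<longrightarrow> less_mod (A i) ?I (F i \<alpha>) (F i \<beta>)"
    and F_cofinal: "\<And>i. i < n \<Longrightarrow>
      \<forall>g\<in>(\<Pi>\<^sub>E k\<in>A i. {..<aleph k}). \<exists>\<alpha>\<in>Field (\<mu> i). less_mod (A i) ?I g (F i \<alpha>)"
    by metis
  define T where "T = (\<lambda>i. trace (A i) (F i))"
  \<comment> \<open>\<open>\<D> i\<close> collects the possible contributions of the levels below \<open>i\<close>, which are treated later but
    are covered by sets known in advance; there are fewer than \<open>\<mu> i\<close> of them.\<close>
  define \<D> where "\<D> = rec_nat {{}} (\<lambda>i \<E>. \<Union>D\<in>\<E>. (\<lambda>C. D \<union> T i C) ` \<P> i)"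
  have \<D>_0: "\<D> 0 = {{}}" and \<D>_Suc: "\<D> (Suc i) = (\<Union>D\<in>\<D> i. (\<lambda>C. D \<union> T i C) ` \<P> i)" for i
    unfolding \<D>_def by simp_all
  have Cinf: "Cinfinite (\<mu> i)" "regularCard (\<mu> i)" if "i < n" for i
    using tcf[OF that] unfolding has_tcf_def by blast+
  have T: "T i C \<subseteq> aleph_omega" "|T i C| \<le>o ?m" if "i < n" "C \<subseteq> Field (\<mu> i)" "|C| \<le>o ?m" for i C
  proof -
    show "T i C \<subseteq> aleph_omega"
      unfolding T_def using F[OF that(1)] that(2) by (intro trace_subset_omega) blast
    show "|T i C| \<le>o ?m"
      unfolding T_def using that(3) by (rule trace_card)
  qed
  have \<D>_small: "D \<subseteq> aleph_omega \<and> |D| \<le>o ?m" if "i \<le> n" "D \<in> \<D> i" for i D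
    using that
  proof (induction i arbitrary: D)
    case 0
    then show ?case
      unfolding \<D>_0 using finite_ordLeq_aleph[OF alephs] by auto
  next
    case (Suc i)
    then obtain D' C where "D' \<in> \<D> i" "C \<in> \<P> i" "D = D' \<union> T i C"
      unfolding \<D>_Suc by blast
    then show ?case
      using Suc.IH[of D'] Suc.prems(1) \<P>(2)[of i C] T[of i C] Un_ordLeq_aleph[OF alephs] by auto
  qed
  have \<D>_card: "|\<D> i| <o \<mu> i" if "i < n" for i
    using that
  proof (induction i)
    case 0
    have "|\<D> 0| \<le>o ?m"
      unfolding \<D>_0 by (rule finite_ordLeq_aleph[OF alephs]) simp
    then show ?case
      using \<mu>(2)[OF 0] ordLeq_ordLess_trans by blast
  next
    case (Suc i)
    then have i: "i < n" by simp
    \<comment> \<open>Fewer than \<open>\<mu> i\<close> choices of \<open>D\<close> times at most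
      \<open>\<mu> i\<close> choices of \<open>C\<close> stay within \<open>\<mu> i\<close>, which
      is strictly below the next true cofinality.\<close>
    have "|\<D> (Suc i)| \<le>o \<mu> i"
      unfolding \<D>_Suc using Suc.IH[OF i] ordLess_imp_ordLeq \<P>(1)[OF i] card_of_image ordLeq_transitive
      by (intro UNION_Cinfinite_bound Cinf(1)[OF i]) blast+
    then show ?case
      using \<mu>(1)[OF Suc.prems] ordLeq_ordLess_trans by blast
  qed
  \<comment> \<open>The levels from \<open>t\<close> on are finished, uniformly for all
    \<open>D\<close> that the levels below \<open>t\<close> may contribute.\<close>
  define good where "good = (\<lambda>t Z. Z \<subseteq> aleph_omega \<and> |Z| \<le>o ?m \<and> (\<forall>D\<in>\<D> t. \<forall>i<n. t \<le> i \<longrightarrow>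
    (\<exists>e. finite e \<and> (\<forall>k\<in>A i - e. cofinal_in Z (Z \<union> D \<union> {..<aleph (k - 1)}) k (\<kappa> i)))))"
  have "\<exists>Z. good 0 Z"
  proof (rule inc_induct[of 0 n])
    have "good n {}"
      unfolding good_def using finite_ordLeq_aleph[OF alephs] by auto
    then show "\<exists>Z. good n Z" ..
  next
    fix t
    assume t: "t < n" and "\<exists>Z. good (Suc t) Z"
    then obtain Z where Z: "good (Suc t) Z"
      by blast
    have Z_small: "Z \<subseteq> aleph_omega" "|Z| \<le>o ?m"
      using Z unfolding good_def by blast+
    have \<D>_small_t: "\<And>D. D \<in> \<D> t \<Longrightarrow> D \<subseteq> aleph_omega \<and> |D| \<le>o ?m"
      using \<D>_small[OF less_imp_le[OF t]] .
    obtain C \<Gamma> where C: "C \<in> \<P> t" and \<Gamma>: "\<Gamma> \<subseteq> C" "\<Gamma> \<subseteq> Field (\<mu> t)" "|\<Gamma>| \<le>o ?m"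
      and new: "\<And>D. D \<in> \<D> t \<Longrightarrow> \<exists>e. finite e \<and>
        (\<forall>k\<in>A t - e. cofinal_in (T t \<Gamma>) (Z \<union> T t \<Gamma> \<union> D \<union> {..<aleph (k - 1)}) k (\<kappa> t))"
      using prescribe_cofinality_mod_finite[OF Cinf[OF t] F[OF t, rule_format]
          F_less[OF t, rule_format] F_cofinal[OF t, rule_format] A[OF t] \<kappa>[OF t] \<P>(3)[OF t]
          Z_small \<D>_card[OF t] \<D>_small_t]
      unfolding T_def by blast
    let ?Z = "Z \<union> T t \<Gamma>"
    have "\<exists>e. finite e \<and> (\<forall>k\<in>A i - e. cofinal_in ?Z (?Z \<union> D \<union> {..<aleph (k - 1)}) k (\<kappa> i))"
      if D: "D \<in> \<D> t" and i: "i < n" "t \<le> i" for D i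
    proof (cases "i = t")
      case True
      then show ?thesis
        using new[OF D] cofinal_in_mono by (meson Un_upper2 subset_refl)
    next
      case False
      \<comment> \<open>\<open>\<Gamma>\<close> was unknown when level \<open>i\<close> was treated,
        but the covering set \<open>C\<close> was among those taken into account.\<close>
      have "D \<union> T t C \<in> \<D> (Suc t)"
        unfolding \<D>_Suc using D C by blast
      then obtain e where "finite e"
        "\<forall>k\<in>A i - e. cofinal_in Z (Z \<union> (D \<union> T t C) \<union> {..<aleph (k - 1)}) k (\<kappa> i)"
        using Z i False unfolding good_def by (metis le_neq_implies_less Suc_leI)
      moreover have "T t \<Gamma> \<subseteq> T t C"
        unfolding T_def using \<Gamma>(1) by (rule trace_mono)
      then have "?Z \<union> D \<union> {..<aleph (k - 1)} \<subseteq> Z \<union> (D \<union> T t C) \<union> {..<aleph (k - 1)}" for k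
        by blast
      ultimately show ?thesis
        using cofinal_in_mono by (meson Un_upper1)
    qed
    moreover have "?Z \<subseteq> aleph_omega" "|?Z| \<le>o ?m"
      using Z_small T[OF t \<Gamma>(2,3)] Un_ordLeq_aleph[OF alephs] by blast+
    ultimately have "good t ?Z"
      unfolding good_def by blast
    then show "\<exists>Z. good t Z" ..
  qed simp
  \<comment> \<open>At level 0 the only \<open>D\<close> left is the empty set.\<close>
  then show ?thesis
    unfolding good_def \<D>_0 by auto
qed

text \<open>Coordinates are repaired from \<open>K\<close> down to \<open>Suc m\<close>. The new
  ordinals for \<open>Suc t\<close> lie below \<open>aleph (Suc t)\<close>, and for every
  \<open>k > Suc t\<close> this is contained in \<open>aleph (k - 1)\<close>, whose elements the
  hull at \<open>k\<close> already has as generators.\<close>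

lemma prescribe_finitely_many_cofinalities:
  assumes Y: "Y \<subseteq> aleph_omega" "|Y| \<le>o |{..<aleph m :: 'a}|"
    and \<tau>: "\<And>k. regular_uncountable (\<tau> k)" "\<And>k. |{..<\<tau> k}| \<le>o |{..<aleph m :: 'a}|" and K: "m \<le> K"
  shows "\<exists>X. Y \<subseteq> X \<and> X \<subseteq> Y \<union> {..<aleph K} \<and> |X| \<le>o |{..<aleph m :: 'a}| \<and>
    (\<forall>k. m < k \<and> k \<le> K \<longrightarrow> cofinal_in X (X \<union> {..<aleph (k - 1)}) k (\<tau> k))"
proof -
  define good where "good = (\<lambda>t X. Y \<subseteq> X \<and> X \<subseteq> Y \<union> {..<aleph K} \<and> |X| \<le>o |{..<aleph m :: 'a}| \<and>
    (\<forall>k. t < k \<and> k \<le> K \<longrightarrow> cofinal_in X (X \<union> {..<aleph (k - 1)}) k (\<tau> k)))"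
  have "\<exists>X. good t X" if "m \<le> t" "t \<le> K" for t
    using that(2,1)
  proof (induction t rule: inc_induct)
    case base
    have "good K Y"
      using Y(2) unfolding good_def by auto
    then show ?case ..
  next
    case (step t)
    then have "\<exists>X. good (Suc t) X"
      by simp
    then obtain X where X: "Y \<subseteq> X" "X \<subseteq> Y \<union> {..<aleph K}" "|X| \<le>o |{..<aleph m :: 'a}|"
      and X_cofinal: "\<And>k. Suc t < k \<Longrightarrow> k \<le> K \<Longrightarrow> cofinal_in X (X \<union> {..<aleph (k - 1)}) k (\<tau> k)"
      unfolding good_def by blast
    have "X \<subseteq> aleph_omega"
      using X(2) Y(1) aleph_subset_omega by blast
    then obtain \<Gamma> where \<Gamma>: "\<Gamma> \<subseteq> {..<aleph (Suc t)}" "|\<Gamma>| \<le>o |{..<aleph m :: 'a}|"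
      "cofinal_in \<Gamma> (X \<union> \<Gamma> \<union> {..<aleph t}) (Suc t) (\<tau> (Suc t))"
      using prescribe_cofinality_at_aleph[OF \<tau> _ X(3) \<open>m \<le> t\<close>] by blast
    have aleph_le: "{..<aleph i} \<subseteq> {..<aleph j :: 'a}" if "i \<le> j" for i j
      using aleph_mono[OF alephs that] by force
    have "cofinal_in (X \<union> \<Gamma>) (X \<union> \<Gamma> \<union> {..<aleph (k - 1)}) k (\<tau> k)" if k: "t < k" "k \<le> K" for k
    proof (cases "k = Suc t")
      case True
      then show ?thesis
        using cofinal_in_mono[OF \<Gamma>(3)] by auto
    next
      case False
      then have "Suc t \<le> k - 1"
        using k(1) by simp
      then have "\<Gamma> \<subseteq> {..<aleph (k - 1)}"
        by (rule subset_trans[OF \<Gamma>(1) aleph_le])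
      then have "X \<union> \<Gamma> \<union> {..<aleph (k - 1)} \<subseteq> X \<union> {..<aleph (k - 1)}"
        by blast
      then show ?thesis
        using cofinal_in_mono[OF X_cofinal] False k by auto
    qed
    moreover have "X \<union> \<Gamma> \<subseteq> Y \<union> {..<aleph K}"
      using X(2) subset_trans[OF \<Gamma>(1) aleph_le[OF Suc_leI[OF \<open>t < K\<close>]]] by blast
    ultimately have "good t (X \<union> \<Gamma>)"
      using X(1) Un_ordLeq_aleph[OF alephs X(3) \<Gamma>(2)] unfolding good_def by blast
    then show ?case ..
  qed
  then show ?thesis
    using K unfolding good_def by blast
qed

end

text \<open>Disjointness lets the targets be indexed by the coordinate \<open>k\<close>; the default
  \<open>c\<close> gives \<open>\<tau>\<close> a value at coordinates in no
  \<open>A i\<close>.\<close>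

lemma disjoint_family_function:
  assumes "disjoint_family_on A I"
  obtains \<tau> where "\<And>i k. i \<in> I \<Longrightarrow> k \<in> A i \<Longrightarrow> \<tau> k = \<kappa> i" "\<And>k. \<tau> k \<in> insert c (\<kappa> ` I)"
proof -
  define \<tau> where "\<tau> = (\<lambda>k. if \<exists>i\<in>I. k \<in> A i then \<kappa> (SOME i. i \<in> I \<and> k \<in> A i) else c)"
  have some: "(SOME i. i \<in> I \<and> k \<in> A i) = i" if "i \<in> I" "k \<in> A i" for i k
    using that assms unfolding disjoint_family_on_def by (intro some_equality) auto
  have "\<tau> k = \<kappa> i" if "i \<in> I" "k \<in> A i" for i k
    using that some[OF that] unfolding \<tau>_def by auto
  moreover have "\<tau> k \<in> insert c (\<kappa> ` I)" for k
    using some unfolding \<tau>_def by auto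
  ultimately show ?thesis
    by (rule that)
qed

theorem theorem3p1:
  fixes n m :: nat
    and A :: "nat \<Rightarrow> nat set"
    and \<kappa> :: "nat \<Rightarrow> 'a::wellorder"
  assumes alephs: "alephs_exist TYPE('a)"
    and n: "n \<ge> 1"
    and max_pcf: "\<exists>\<mu>. nth_cardSuc n |aleph_omega :: 'a set| \<mu> \<and>
                      is_max_pcf (range (aleph :: nat \<Rightarrow> 'a)) \<mu>"
    and m: "1 < m"
    and A_disjoint: "disjoint_family_on A {1..n}"
    and A_subset: "\<And>i. i \<in> {1..n} \<Longrightarrow> A i \<subseteq> UNIV - {..<m + 1}"
    and A_tcf: "\<And>i. i \<in> {1..n} \<Longrightarrow>
        \<exists>\<mu> :: ('a \<Rightarrow> 'a) rel. nth_cardSuc i |aleph_omega :: 'a set| \<mu> \<and>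
          has_tcf (A i) (aleph :: nat \<Rightarrow> 'a) {X. finite X} \<mu>"
    and \<kappa>: "\<And>i. i \<in> {1..n} \<Longrightarrow> is_cardinal (\<kappa> i) \<and> aleph 0 < \<kappa> i \<and> \<kappa> i < aleph (m + 1)"
  shows "stationary_in
           {x. x \<subseteq> aleph_omega \<and> |x| \<le>o |{..<aleph m :: 'a}| \<and>
               (\<forall>i\<in>{1..n}. \<forall>k\<in>A i. cf (x \<inter> {..<aleph k}) = \<kappa> i)}
           (aleph_omega :: 'a set)
           |{..<aleph (m + 1) :: 'a}|"
proof -
  let ?W = "aleph_omega :: 'a set"
  let ?m = "|{..<aleph m :: 'a}|"
  let ?S = "{x. x \<subseteq> ?W \<and> |x| \<le>o ?m \<and> (\<forall>i\<in>{1..n}. \<forall>k\<in>A i. cf (x \<inter> {..<aleph k}) = \<kappa> i)}"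
  have \<kappa>_regular: "regular_uncountable (\<kappa> i)" "|{..<\<kappa> i}| \<le>o ?m" if i: "i \<in> {1..n}" for i
  proof -
    obtain j where "j < m" "\<kappa> i = aleph (Suc j)"
      using cardinal_between_alephs[OF alephs, of "\<kappa> i" m] \<kappa>[OF i] by auto
    then show "regular_uncountable (\<kappa> i)" "|{..<\<kappa> i}| \<le>o ?m"
      using regular_uncountable_aleph_Suc[OF alephs] ordLeq_aleph_mono[OF alephs, of "Suc j" m] by auto
  qed
  have "\<forall>i. \<exists>\<mu> :: ('a \<Rightarrow> 'a) rel. i < n \<longrightarrow> nth_cardSuc (Suc i) |?W| \<mu> \<and>
      has_tcf (A (Suc i)) (aleph :: nat \<Rightarrow> 'a) {X. finite X} \<mu>"
  proof (intro allI)
    fix i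
    show "\<exists>\<mu> :: ('a \<Rightarrow> 'a) rel. i < n \<longrightarrow> nth_cardSuc (Suc i) |?W| \<mu> \<and>
      has_tcf (A (Suc i)) (aleph :: nat \<Rightarrow> 'a) {X. finite X} \<mu>"
      using A_tcf[of "Suc i"] by (cases "i < n") (simp only: atLeastAtMost_iff, force)+
  qed
  then obtain \<mu> :: "nat \<Rightarrow> ('a \<Rightarrow> 'a) rel" where \<mu>: "\<And>i. i < n \<Longrightarrow> nth_cardSuc (Suc i) |?W| (\<mu> i)"
    and tcf: "\<And>i. i < n \<Longrightarrow> has_tcf (A (Suc i)) (aleph :: nat \<Rightarrow> 'a) {X. finite X} (\<mu> i)"
    by metis
  have "?S \<inter> C \<noteq> {}" if C: "club_in C ?W |{..<aleph (Suc m) :: 'a}|" for C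
  proof -
    obtain cl where "finitary_hull cl m"
      and cl_C: "\<And>X. X \<subseteq> ?W \<Longrightarrow> |X| \<le>o ?m \<Longrightarrow> cl X \<in> C"
      using club_finitary_hull[OF alephs C] by blast
    then interpret finitary_hull cl m
      by simp
    have m_less: "?m <o \<mu> i" if "i < n" for i
      using nth_cardSuc_greater[OF \<mu>[OF that]] card_of_mono1[OF aleph_subset_omega] ordLeq_ordLess_trans by blast
    have \<mu>_less: "\<mu> i <o \<mu> (Suc i)" if "Suc i < n" for i
      using nth_cardSuc_less[OF \<mu> \<mu>] that by simp
    have A_above: "A (Suc i) \<subseteq> {Suc m..}" if "i < n" for i
      using A_subset[of "Suc i"] that by force
    have \<kappa>_Suc: "regular_uncountable (\<kappa> (Suc i))" "|{..<\<kappa> (Suc i)}| \<le>o ?m" if "i < n" for i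
      using \<kappa>_regular[of "Suc i"] that by simp_all
    obtain Y where Y: "Y \<subseteq> ?W" "|Y| \<le>o ?m" and
      "\<forall>i<n. \<exists>e. finite e \<and> (\<forall>k\<in>A (Suc i) - e. cofinal_in Y (Y \<union> {..<aleph (k - 1)}) k (\<kappa> (Suc i)))"
      using prescribe_cofinalities_mod_finite[of n "\<lambda>i. A (Suc i)" \<mu> "\<lambda>i. \<kappa> (Suc i)",
          OF A_above tcf \<mu>_less m_less \<kappa>_Suc] by blast
    then obtain e where e: "\<And>i. i < n \<Longrightarrow> finite (e i)"
      and cofinal: "\<And>i k. i < n \<Longrightarrow> k \<in> A (Suc i) - e i \<Longrightarrow>
        cofinal_in Y (Y \<union> {..<aleph (k - 1)}) k (\<kappa> (Suc i))"
      by metis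
    have "finite (\<Union>i<n. e i)"
      using e by blast
    then obtain K' where K': "\<And>i k. i < n \<Longrightarrow> k \<in> e i \<Longrightarrow> k \<le> K'"
      unfolding finite_nat_set_iff_bounded_le by blast
    \<comment> \<open>Beyond \<open>K'\<close> no coordinate is exceptional at any level; the
      maximum with \<open>m\<close> meets the requirement \<open>m \<le> K\<close> of the
      repair.\<close>
    define K where "K = max m K'"
    have "m \<le> K"
      unfolding K_def by simp
    \<comment> \<open>The default \<open>\<kappa> 1\<close> is itself one of the prescribed
      cofinalities because \<open>n \<ge> 1\<close>, so every \<open>\<tau> k\<close> is regular and
      small.\<close>
    obtain \<tau> where \<tau>: "\<And>i k. i \<in> {1..n} \<Longrightarrow> k \<in> A i \<Longrightarrow> \<tau> k = \<kappa> i"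
      and "\<And>k. \<tau> k \<in> insert (\<kappa> 1) (\<kappa> ` {1..n})"
      using disjoint_family_function[OF A_disjoint, where \<kappa> = \<kappa> and c = "\<kappa> 1"] by blast
    then have "\<tau> k \<in> \<kappa> ` {1..n}" for k
      using n by (metis atLeastAtMost_iff imageI insertE order_refl)
    then have \<tau>_regular: "regular_uncountable (\<tau> k)" "|{..<\<tau> k}| \<le>o ?m" for k
      using \<kappa>_regular by (metis imageE)+
    obtain X where X: "Y \<subseteq> X" "X \<subseteq> Y \<union> {..<aleph K}" "|X| \<le>o ?m"
      and X_cofinal: "\<And>k. m < k \<Longrightarrow> k \<le> K \<Longrightarrow> cofinal_in X (X \<union> {..<aleph (k - 1)}) k (\<tau> k)"
      using prescribe_finitely_many_cofinalities[where \<tau> = \<tau>, OF Y \<tau>_regular \<open>m \<le> K\<close>] by blast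
    have X_omega: "X \<subseteq> ?W"
      using X(2) Y(1) aleph_subset_omega by blast
    have "cf (cl X \<inter> {..<aleph k}) = \<kappa> i" if i: "i \<in> {1..n}" and k: "k \<in> A i" for i k
    proof (rule cf_hull_eqI[OF \<kappa>_regular(1)[OF i] _ X_omega])
      show "is_cardinal (\<kappa> i)"
        using \<kappa>[OF i] by blast
      have "m < k"
        using A_subset[OF i] k by auto
      show "cofinal_in X X k (\<kappa> i)"
      proof (cases "k \<le> K")
        case True
        then have "cofinal_in X (X \<union> {..<aleph (k - 1)}) k (\<kappa> i)"
          using X_cofinal[OF \<open>m < k\<close>] \<tau>[OF i k] by simp
        then show ?thesis
          by (rule cofinal_in_mono) auto
      next
        case False
        \<comment> \<open>Beyond \<open>K\<close> the repair adds only ordinals below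
          \<open>aleph (k - 1)\<close>, which were already allowed for when \<open>Y\<close> was
          chosen.\<close>
        then have "{..<aleph K} \<subseteq> {..<aleph (k - 1) :: 'a}"
          using aleph_mono[OF alephs, of K "k - 1"] by force
        then have sub: "X \<subseteq> Y \<union> {..<aleph (k - 1)}"
          by (rule subset_trans[OF X(2) Un_mono[OF subset_refl]])
        obtain i' where i': "i = Suc i'" "i' < n"
          using i by (cases i) auto
        have "k \<notin> e i'"
          using K'[OF i'(2), of k] False unfolding K_def by auto
        then have "cofinal_in Y (Y \<union> {..<aleph (k - 1)}) k (\<kappa> i)"
          using cofinal[OF i'(2), of k] k unfolding i'(1) by blast
        then show ?thesis
          using X(1) sub by (rule cofinal_in_mono)
      qed
    qed
    moreover have "cl X \<in> C"
      using cl_C X_omega X(3) by blast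
    moreover have "cl X \<in> subsets_lt ?W |{..<aleph (Suc m) :: 'a}|"
      using \<open>cl X \<in> C\<close> C unfolding club_in_def by blast
    ultimately have "cl X \<in> ?S \<inter> C"
      unfolding subsets_lt_def ordLess_aleph_Suc_iff[OF alephs] by blast
    then show ?thesis
      by blast
  qed
  moreover have "?S \<subseteq> subsets_lt ?W |{..<aleph (Suc m) :: 'a}|"
    unfolding subsets_lt_def ordLess_aleph_Suc_iff[OF alephs] by blast
  ultimately show ?thesis
    unfolding stationary_in_def Suc_eq_plus1[symmetric] by blast
qed

end
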